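(* Suppose there exist a language $g\in\mathbf{E}$ and $\iota>0$ such that, for every $n$, every Boolean circuit computing $g|_n$ has size at least $2^{\iota n}$. Then for every $\gamma>0$ there exist $\epsilon\in(0,1/2)$, $\delta\in(0,1)$ and $c,d\in\mathbb{N}^+$ such that $$G^d_{\mathcal{U}^c\to\mathcal{C}}(\epsilon,\delta,n)\in\Omega(n^{1+\gamma})\quad\text{as } n\to\infty.$$
   Context: Let $\mathcal{B}=\{0,1\}$, let $\mathcal{B}^*$ be the set of finite binary strings and $|h|$ the length of $h\in\mathcal{B}^*$. For $n\in\mathbb{N}^+$, $H^n$ is the set of all functions $\mathcal{B}^n\to\mathcal{B}$ and $\Delta(\mathcal{B}^n)$ the set of probability distributions on $\mathcal{B}^n$. A learning problem is a pair $(f,\mathcal{P})$ with $f\in H^n$, $\mathcal{P}\in\Delta(\mathcal{B}^n)$; an $m$-sample dataset for it is the random sequence $[(x_j,f(x_j))]_{j=1}^m$ with $x_1,\dots,x_m$ i.i.d. $\sim\mathcal{P}$. The accuracy of $\hat f\in H^n$ is $\mathrm{acc}^{\mathcal{P}}_f(\hat f)=\Pr_{x\sim\mathcal{P}}[\hat f(x)=f(x)]$. For $\epsilon\in(0,1/2)$, $\delta\in(0,1)$, an algorithm $\mathcal{A}$ has an $(\epsilon,\delta)$-PAC-learning performance with an $m$-sample dataset on $(f,\mathcal{P})$ if for every $m'\ge m$, with probability at least $1-\delta$ over an $m'$-sample dataset $S$, $\mathrm{acc}^{\mathcal{P}}_f(\mathcal{A}(S))\ge 1-\epsilon$. An interpreter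 is a Turing machine computing a partial function $\varphi:\mathcal{B}^*\times\mathcal{B}^*\to\mathcal{B}\cup\{\bot\}$, where $\bot$ denotes non-halting (or invalid) output. For $f\in H^n$, $|f|_\varphi=\min\{|h|:\varphi(h,x)=f(x)\ \forall x\in\mathcal{B}^n\}$ ($+\infty$ if no such $h$). The learning algorithm $\mathit{MDL}^\varphi$, on a dataset $[(x_j,y_j)]_{j=1}^m$ with $x_j\in\mathcal{B}^n$, selects $h^*$ of minimal length among all $h$ with $\varphi(h,x_j)=y_j$ for all $j$ and $\varphi(h,x)\neq\bot$ for all $x\in\mathcal{B}^n$ (ties broken arbitrarily) and outputs $x\mapsto\varphi(h^*,x)$ on $\mathcal{B}^n$. $m^{\epsilon,\delta}_\varphi(f,\mathcal{P})$ is the least $m\in\mathbb{N}^+$ such that $\mathit{MDL}^\varphi$ has an $(\epsilon,\delta)$-PAC-learning performance with an $m$-sample dataset on $(f,\mathcal{P})$ ($+\infty$ if none). For interpreters $\varphi,\psi$ and $n,d\in\mathbb{N}^+$, the sample efficiency gain is $G^d_{\varphi\to\psi}(\epsilon,\delta,n)=\sup\{ m^{\epsilon,\delta}_\psi(f,\mathcal{P})/m^{\epsilon,\delta}_\varphi(f,\mathcal{P}) : f\in H^n,\ \mathcal{P}\in\Delta(\mathcal{B}^n),\ |f|_\varphi\le n^d\}$. Turing machines have alphabet $\{0,1,b\}$ ($b$ blank), a finite state set containing an initial state and two final states accept/reject; the output is $1$ if halting in accept, $0$ if halting in reject, $\bot$ otherwise; multi-tape machines have read-only input tapes and read/write work tapes,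 and the transition function is a finite list of rules. $E(T)$ is a fixed prefix-free binary encoding of a machine $T$ listing its rules (of length at least 2 for every machine). For $c\in\mathbb{N}^+$, $\mathcal{U}^c$ is a time-bounded universal interpreter (a 2-input-tape, 3-work-tape machine): on $(p,x)$ with $n=|x|$, it checks within $n^c$ steps whether $p=E(T)u$ for a two-input-tape machine $T$ and $u\in\mathcal{B}^*$ (outputting $\bot$ if not, or if the check does not finish), then simulates $T$ on $(u,x)$ with an efficient universal simulation (Hennie–Stearns, overhead $O(t\log t)$ for $t$ simulated steps), devoting at most $n^c$ of its own steps to the simulation; it outputs $T$'s output if $T$ halts within this budget and $0$ otherwise. For fixed $p$ it runs in at most $\beta n^c$ steps for a constant $\beta$. In particular, if a Turing machine computes $g:\mathcal{B}^*\to\mathcal{B}$ in time $O(n^{c'})$ with $c'<c$, there is $h\in\mathcal{B}^*$ with $\mathcal{U}^c(h,x)=g(x)$ for all $x$ of sufficiently large length. A Boolean circuit on $n$ inputs is a DAG with a unique sink (output) whose sources are labelled by input indices in $\{1,\dots,n\}$ and whose other vertices (gates) are labelled AND, OR (two incoming edges) or NOT (one incoming edge); its size $|C|$ is its number of vertices. The circuit interpreter $\mathcal{C}$ reads a program $h=0^{\lceil\log_2 n\rceil}1\,[\text{binary expansion of } n]\,0^{|C|}1\,[\text{description of vertex } i]_{i=1}^{|C|}$, each vertex being described by its label and its parents/input index using $\max\{2\lceil\log_2|C|\rceil,\lceil\log_2 n\rceil\}$ bits beyond the label bits, so a circuit $C$ on $n$ inputs has encoding length $L(|C|,n)=2\lceil\log_2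 n\rceil+2+|C|(3+\max\{2\lceil\log_2|C|\rceil,\lceil\log_2 n\rceil\})$; $\mathcal{C}(h,x)$ is the circuit's output on $x\in\mathcal{B}^n$, and $\bot$ if $h$ is malformed. Hence $|f|_{\mathcal{C}}=\min\{L(|C|,n): C \text{ computes } f\}$. A language is a subset $L\subseteq\mathcal{B}^*$, identified with its indicator function; $L|_n\in H^n$ is its restriction to inputs of length $n$. $\mathbf{E}$ is the class of languages decidable by a deterministic Turing machine in time $2^{O(n)}$. *)

theory Defs
  imports "HOL-Probability.Probability_Mass_Function" "HOL-Library.Extended_Real"
begin

text \<open>An interpreter maps (program, input) to an output in B, or None for the symbol bottom.\<close>
type_synonym interp = "bool list \<Rightarrow> bool list \<Rightarrow> bool option"

datatype sym = Zero | One | Blank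
datatype mv = MvL | MvR | MvS

text \<open>A rule (q, r, q', w, m): in state q reading the symbols r (input tapes, then work tapes)
  go to state q', write w on the work tapes and move the heads according to m.
  The first matching rule in the list is applied.\<close>
record tm =
  nin :: nat
  nwork :: nat
  q0 :: nat
  qacc :: nat
  qrej :: nat
  rules :: "(nat \<times> sym list \<times> nat \<times> sym list \<times> mv list) list"

type_synonym config = "nat \<times> int list \<times> (int \<Rightarrow> sym) list"

definition wf_tm :: "tm \<Rightarrow> bool" where
  "wf_tm M \<longleftrightarrow> qacc M \<noteq> qrej M \<and>
     (\<forall>(q, r, q', w, m) \<in> set (rules M).
        length r = nin M + nwork M \<and> length w = nwork M \<and> length m = nin M + nwork M)"

definition inp_sym :: "bool list \<Rightarrow> int \<Rightarrow> sym" where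
  "inp_sym x i = (if 0 \<le> i \<and> i < int (length x) then (if x ! nat i then One else Zero) else Blank)"

definition mvh :: "int \<Rightarrow> mv \<Rightarrow> int" where
  "mvh h m = (case m of MvL \<Rightarrow> h - 1 | MvR \<Rightarrow> h + 1 | MvS \<Rightarrow> h)"

definition reads :: "tm \<Rightarrow> bool list list \<Rightarrow> config \<Rightarrow> sym list" where
  "reads M xs c = (case c of (q, hs, ws) \<Rightarrow>
     map (\<lambda>j. inp_sym (xs ! j) (hs ! j)) [0..<nin M] @
     map (\<lambda>j. (ws ! j) (hs ! (nin M + j))) [0..<nwork M])"

definition halted :: "tm \<Rightarrow> config \<Rightarrow> bool" where
  "halted M c \<longleftrightarrow> fst c = qacc M \<or> fst c = qrej M"

definition step :: "tm \<Rightarrow> bool list list \<Rightarrow> config \<Rightarrow> config option" where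
  "step M xs c = (case c of (q, hs, ws) \<Rightarrow>
     (case find (\<lambda>(p, r, _, _, _). p = q \<and> r = reads M xs c) (rules M) of
        None \<Rightarrow> None
      | Some (_, _, q', w, m) \<Rightarrow>
          Some (q', map (\<lambda>j. mvh (hs ! j) (m ! j)) [0..<nin M + nwork M],
                map (\<lambda>j. (ws ! j)(hs ! (nin M + j) := w ! j)) [0..<nwork M])))"

fun run :: "tm \<Rightarrow> bool list list \<Rightarrow> nat \<Rightarrow> config \<Rightarrow> config option" where
  "run M xs 0 c = Some c"
| "run M xs (Suc t) c = (if halted M c then Some c else Option.bind (step M xs c) (run M xs t))"

definition init_config :: "tm \<Rightarrow> config" where
  "init_config M = (q0 M, replicate (nin M + nwork M) 0, replicate (nwork M) (\<lambda>_. Blank))"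

definition halts_within :: "tm \<Rightarrow> bool list list \<Rightarrow> nat \<Rightarrow> bool \<Rightarrow> bool" where
  "halts_within M xs t b \<longleftrightarrow>
     (\<exists>c. run M xs t (init_config M) = Some c \<and> halted M c \<and> b = (fst c = qacc M))"

definition stops_within :: "tm \<Rightarrow> bool list list \<Rightarrow> nat \<Rightarrow> bool" where
  "stops_within M xs t \<longleftrightarrow>
     (case run M xs t (init_config M) of None \<Rightarrow> True | Some c \<Rightarrow> halted M c)"

definition tm_output :: "tm \<Rightarrow> bool list list \<Rightarrow> bool option" where
  "tm_output M xs = (if \<exists>t b. halts_within M xs t b
                      then Some (THE b. \<exists>t. halts_within M xs t b) else None)"

definition decides_in_time :: "tm \<Rightarrow> (bool list \<Rightarrow> bool) \<Rightarrow> (nat \<Rightarrow> nat) \<Rightarrow> bool" where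
  "decides_in_time M g T \<longleftrightarrow> wf_tm M \<and> nin M = 1 \<and>
     (\<forall>x. \<exists>t \<le> T (length x). halts_within M [x] t (g x))"

definition in_E :: "(bool list \<Rightarrow> bool) \<Rightarrow> bool" where
  "in_E g \<longleftrightarrow> (\<exists>M C. decides_in_time M g (\<lambda>n. 2 ^ (C * (n + 1))))"

definition computable_in_time_pow :: "(bool list \<Rightarrow> bool) \<Rightarrow> real \<Rightarrow> bool" where
  "computable_in_time_pow g c' \<longleftrightarrow> (\<exists>M K N. wf_tm M \<and> nin M = 1 \<and>
     (\<forall>x. \<exists>t. halts_within M [x] t (g x)) \<and>
     (\<forall>x. length x \<ge> N \<longrightarrow> (\<exists>t. real t \<le> K * real (length x) powr c' \<and> halts_within M [x] t (g x))))"

text \<open>Properties of the time-bounded universal interpreter U^c stated in the paper: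
  it is computed by a 2-input-tape, 3-work-tape machine, for fixed p it stops within
  beta n^c steps, and every language computable in time O(n^c') with c' < c is
  represented by some program on all sufficiently long inputs.\<close>
definition time_bounded_universal :: "nat \<Rightarrow> interp \<Rightarrow> bool" where
  "time_bounded_universal c U \<longleftrightarrow>
     (\<exists>M. wf_tm M \<and> nin M = 2 \<and> nwork M = 3 \<and> (\<forall>p x. U p x = tm_output M [p, x]) \<and>
        (\<forall>p. \<exists>\<beta>::real. \<forall>x. length x \<ge> 1 \<longrightarrow>
            (\<exists>t. real t \<le> \<beta> * real (length x) ^ c \<and> stops_within M [p, x] t))) \<and>
     (\<forall>g c'. c' < real c \<and> computable_in_time_pow g c' \<longrightarrow>
        (\<exists>h N. \<forall>x. length x \<ge> N \<longrightarrow> U h x = Some (g x)))"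

datatype vtx = Inp nat | And nat nat | Or nat nat | Not nat

definition parents :: "vtx \<Rightarrow> nat set" where
  "parents v = (case v of Inp _ \<Rightarrow> {} | And a b \<Rightarrow> {a, b} | Or a b \<Rightarrow> {a, b} | Not a \<Rightarrow> {a})"

definition circ_edges :: "vtx list \<Rightarrow> (nat \<times> nat) set" where
  "circ_edges vs = {(p, v). v < length vs \<and> p \<in> parents (vs ! v)}"

definition sinks :: "vtx list \<Rightarrow> nat set" where
  "sinks vs = {v. v < length vs \<and> (\<forall>u < length vs. v \<notin> parents (vs ! u))}"

definition valid_circuit :: "nat \<Rightarrow> vtx list \<Rightarrow> bool" where
  "valid_circuit n vs \<longleftrightarrow> n \<ge> 1 \<and> vs \<noteq> [] \<and>
     (\<forall>v \<in> set vs. (\<forall>i. v = Inp i \<longrightarrow> i < n) \<and> (\<forall>p \<in> parents v. p < length vs)) \<and>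
     acyclic (circ_edges vs) \<and> card (sinks vs) = 1"

fun ev :: "nat \<Rightarrow> vtx list \<Rightarrow> bool list \<Rightarrow> nat \<Rightarrow> bool" where
  "ev 0 vs x v = False"
| "ev (Suc k) vs x v = (case vs ! v of
      Inp i \<Rightarrow> x ! i
    | And a b \<Rightarrow> ev k vs x a \<and> ev k vs x b
    | Or a b \<Rightarrow> ev k vs x a \<or> ev k vs x b
    | Not a \<Rightarrow> \<not> ev k vs x a)"

text \<open>Output of the circuit = value at its unique sink (depth is at most the size).\<close>
definition circ_eval :: "vtx list \<Rightarrow> bool list \<Rightarrow> bool" where
  "circ_eval vs x = ev (length vs) vs x (THE v. v \<in> sinks vs)"

definition circ_computes :: "nat \<Rightarrow> vtx list \<Rightarrow> (bool list \<Rightarrow> bool) \<Rightarrow> bool" where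
  "circ_computes n vs f \<longleftrightarrow> valid_circuit n vs \<and> (\<forall>x. length x = n \<longrightarrow> circ_eval vs x = f x)"

definition clog :: "nat \<Rightarrow> nat" where
  "clog n = (LEAST k. n \<le> 2 ^ k)"

definition bits :: "nat \<Rightarrow> nat \<Rightarrow> bool list" where
  "bits k v = map (\<lambda>j. odd (v div 2 ^ (k - 1 - j))) [0..<k]"

definition venc :: "nat \<Rightarrow> nat \<Rightarrow> vtx \<Rightarrow> bool list" where
  "venc n s v = (let w = max (2 * clog s) (clog n) in case v of
      Inp i \<Rightarrow> [False, False] @ bits w i
    | And a b \<Rightarrow> [False, True] @ bits (clog s) a @ bits (clog s) b @ replicate (w - 2 * clog s) False
    | Or a b \<Rightarrow> [True, False] @ bits (clog s) a @ bits (clog s) b @ replicate (w - 2 * clog s) False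
    | Not a \<Rightarrow> [True, True] @ bits (clog s) a @ replicate (w - clog s) False)"

definition circ_enc :: "nat \<Rightarrow> vtx list \<Rightarrow> bool list" where
  "circ_enc n vs = replicate (clog n) False @ [True] @ bits (clog n) (n - 1) @
     replicate (length vs) False @ [True] @ concat (map (venc n (length vs)) vs)"

definition circuit_interp :: interp where
  "circuit_interp h x = (if \<exists>n vs. valid_circuit n vs \<and> circ_enc n vs = h \<and> length x = n
     then Some (circ_eval (SOME vs. \<exists>n. valid_circuit n vs \<and> circ_enc n vs = h) x) else None)"

definition desc_len :: "interp \<Rightarrow> nat \<Rightarrow> (bool list \<Rightarrow> bool) \<Rightarrow> enat" where
  "desc_len \<phi> n f = (if \<exists>h. \<forall>x. length x = n \<longrightarrow> \<phi> h x = Some (f x)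
     then enat (LEAST l. \<exists>h. length h = l \<and> (\<forall>x. length x = n \<longrightarrow> \<phi> h x = Some (f x)))
     else \<infinity>)"

definition consistent :: "interp \<Rightarrow> nat \<Rightarrow> (bool list \<times> bool) list \<Rightarrow> bool list set" where
  "consistent \<phi> n S = {h. (\<forall>(x, y) \<in> set S. \<phi> h x = Some y) \<and> (\<forall>x. length x = n \<longrightarrow> \<phi> h x \<noteq> None)}"

definition mdl_candidates :: "interp \<Rightarrow> nat \<Rightarrow> (bool list \<times> bool) list \<Rightarrow> bool list set" where
  "mdl_candidates \<phi> n S = {h \<in> consistent \<phi> n S. \<forall>h' \<in> consistent \<phi> n S. length h \<le> length h'}"

type_synonym selector = "(bool list \<times> bool) list \<Rightarrow> bool list set \<Rightarrow> bool list"

definition valid_selector :: "selector \<Rightarrow> bool" where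
  "valid_selector sel \<longleftrightarrow> (\<forall>S A. A \<noteq> {} \<longrightarrow> sel S A \<in> A)"

definition mdl_acc :: "interp \<Rightarrow> selector \<Rightarrow> nat \<Rightarrow> (bool list \<Rightarrow> bool) \<Rightarrow> bool list pmf
     \<Rightarrow> (bool list \<times> bool) list \<Rightarrow> real" where
  "mdl_acc \<phi> sel n f P S = (if mdl_candidates \<phi> n S = {} then 0 else
     measure_pmf.prob P {x. \<phi> (sel S (mdl_candidates \<phi> n S)) x = Some (f x)})"

definition dataset_pmf :: "nat \<Rightarrow> (bool list \<Rightarrow> bool) \<Rightarrow> bool list pmf \<Rightarrow> (bool list \<times> bool) list pmf" where
  "dataset_pmf m f P = map_pmf (map (\<lambda>x. (x, f x))) (replicate_pmf m P)"

definition pac_perf :: "interp \<Rightarrow> selector \<Rightarrow> nat \<Rightarrow> real \<Rightarrow> real \<Rightarrow> nat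
     \<Rightarrow> (bool list \<Rightarrow> bool) \<Rightarrow> bool list pmf \<Rightarrow> bool" where
  "pac_perf \<phi> sel n \<epsilon> \<delta> m f P \<longleftrightarrow> (\<forall>m' \<ge> m.
     measure_pmf.prob (dataset_pmf m' f P) {S. mdl_acc \<phi> sel n f P S \<ge> 1 - \<epsilon>} \<ge> 1 - \<delta>)"

definition sample_cplx :: "interp \<Rightarrow> selector \<Rightarrow> nat \<Rightarrow> real \<Rightarrow> real
     \<Rightarrow> (bool list \<Rightarrow> bool) \<Rightarrow> bool list pmf \<Rightarrow> enat" where
  "sample_cplx \<phi> sel n \<epsilon> \<delta> f P = (if \<exists>m \<ge> 1. pac_perf \<phi> sel n \<epsilon> \<delta> m f P
     then enat (LEAST m. m \<ge> 1 \<and> pac_perf \<phi> sel n \<epsilon> \<delta> m f P) else \<infinity>)"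

definition gain :: "nat \<Rightarrow> interp \<Rightarrow> selector \<Rightarrow> interp \<Rightarrow> selector \<Rightarrow> real \<Rightarrow> real \<Rightarrow> nat \<Rightarrow> ereal" where
  "gain d \<phi> sel\<phi> \<psi> sel\<psi> \<epsilon> \<delta> n = (SUP (f, P) \<in> {(f, P). set_pmf P \<subseteq> {x. length x = n} \<and>
        desc_len \<phi> n f \<le> enat (n ^ d)}.
      ereal_of_enat (sample_cplx \<psi> sel\<psi> n \<epsilon> \<delta> f P) / ereal_of_enat (sample_cplx \<phi> sel\<phi> n \<epsilon> \<delta> f P))"

end

theory Submission
  imports Defs "HOL-Probability.Product_PMF"
begin

text \<open>Deciding \<open>g\<close> on a prefix of length about \<open>a log n\<close> of the input gives a language that
  is decidable in polynomial time but whose restriction to length n needs circuits of size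
  \<open>n\<close> to the power \<open>\<iota> a\<close>. It has a fixed program for \<open>U c\<close>, so a union bound over the
  finitely many programs that are not longer shows that MDL with \<open>U c\<close> needs a bounded number
  of samples, for every distribution. For circuits, worst-case hardness yields one hard distribution
  by Schapire's boosting: if a circuit of size s with error at most 1/6 existed for every
  distribution, then O(log n) nested majorities of three would compute the function exactly
  with size \<open>O(n^3 s)\<close>. Under the hard distribution, MDL on m samples never outputs a circuit larger
  than a lookup table, that is \<open>O(n m)\<close>, so it fails surely while m is at most \<open>n\<close> to the power
  \<open>1 + \<gamma>\<close>.\<close>

section \<open>Boolean circuits\<close>

text \<open>Worst-case hardness says nothing about any given distribution, so the distribution has
  to come out of boosting and may depend on n and on the sample size m. A boosting round turns error
  e into 3 * e^2, that is, it squares 3 * e. This starts at 1/2 when e = 1/6, so after j rounds the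
  error is (1/3) * 2^-(2^j). The cube has 2^n points; hence logarithmically many rounds suffice, and
  a constant size factor per round costs only a polynomial. This fixes \<epsilon> = 1/6. Failure on
  the circuit side is certain, so any \<delta> < 1 would do there. The exponents add up as follows:
  a table for about n^(1 + \<gamma>) samples has O(n^(2 + \<gamma>)) vertices, boosting multiplies
  by n^3, and two more powers of n absorb the constants. Hardness n^(7 + \<gamma>) is therefore
  required, which determines a. The exponent c then follows from a and the running time of g, while
  d = 1 suffices because the program does not change with n.\<close>

definition gate_val :: "vtx \<Rightarrow> bool list \<Rightarrow> (nat \<Rightarrow> bool) \<Rightarrow> bool" where
  "gate_val g x \<rho> = (case g of Inp i \<Rightarrow> x ! i | And a b \<Rightarrow> \<rho> a \<and> \<rho> b | Or a b \<Rightarrow> \<rho> a \<or> \<rho> b | Not a \<Rightarrow> \<not> \<rho> a)"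

lemma ev_Suc: "ev (Suc k) vs x v = gate_val (vs ! v) x (ev k vs x)"
  by (simp add: gate_val_def split: vtx.split)

lemma gate_val_cong:
  "(\<And>p. p \<in> parents g \<Longrightarrow> \<rho> p = \<rho>' p) \<Longrightarrow> gate_val g x \<rho> = gate_val g x \<rho>'"
  by (cases g) (auto simp: gate_val_def parents_def)

text \<open>This is \<open>valid_circuit\<close> without nonemptiness and the single sink. The empty
  list and the disjoint union of two circuits, which has two sinks, occur as stages before an output
  gate is attached.\<close>

definition net :: "nat \<Rightarrow> vtx list \<Rightarrow> bool" where
  "net n vs \<longleftrightarrow> (\<forall>v \<in> set vs. (\<forall>i. v = Inp i \<longrightarrow> i < n) \<and> (\<forall>p \<in> parents v. p < length vs)) \<and>
     acyclic (circ_edges vs)"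

lemma valid_circuit_net:
  "valid_circuit n vs \<longleftrightarrow> n \<ge> 1 \<and> vs \<noteq> [] \<and> net n vs \<and> card (sinks vs) = 1"
  by (auto simp: valid_circuit_def net_def)

lemma net_parents: "net n vs \<Longrightarrow> v < length vs \<Longrightarrow> p \<in> parents (vs ! v) \<Longrightarrow> p < length vs"
  by (auto simp: net_def)

lemma net_inputs: "net n vs \<Longrightarrow> v < length vs \<Longrightarrow> vs ! v = Inp i \<Longrightarrow> i < n"
  by (auto simp: net_def dest: nth_mem)

text \<open>The rank of a vertex is its number of strict ancestors. By acyclicity it grows strictly
  along edges, and a vertex is not its own ancestor, so it stays below the number of vertices. That
  bound is why fuel \<open>length vs\<close> suffices in \<open>circ_eval\<close>.\<close>

lemma net_rank:
  assumes "net n vs"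
  shows "\<exists>r :: nat \<Rightarrow> nat. (\<forall>v < length vs. r v < length vs) \<and>
    (\<forall>v < length vs. \<forall>p \<in> parents (vs ! v). r p < r v)"
proof -
  let ?E = "circ_edges vs"
  let ?r = "\<lambda>v. card {u. (u, v) \<in> ?E\<^sup>+}"
  have ac: "acyclic ?E" using assms by (simp add: net_def)
  have sub: "{u. (u, v) \<in> ?E\<^sup>+} \<subseteq> {..<length vs}" for v
  proof safe
    fix u assume "(u, v) \<in> ?E\<^sup>+"
    then have "u \<in> Domain (?E\<^sup>+)" by (rule DomainI)
    then have "u \<in> Domain ?E" by simp
    then show "u < length vs" using assms by (auto simp: circ_edges_def net_parents)
  qed
  have fin: "finite {u. (u, v) \<in> ?E\<^sup>+}" for v
    by (rule finite_subset[OF sub]) simp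
  have "?r v < length vs" if v: "v < length vs" for v
  proof -
    have "v \<notin> {u. (u, v) \<in> ?E\<^sup>+}" using ac by (simp add: acyclic_def)
    then have "{u. (u, v) \<in> ?E\<^sup>+} \<subset> {..<length vs}" using sub[of v] v by blast
    then show ?thesis using psubset_card_mono[of "{..<length vs}"] by simp
  qed
  moreover have "?r p < ?r v" if v: "v < length vs" and p: "p \<in> parents (vs ! v)" for v p
  proof -
    have e: "(p, v) \<in> ?E" using v p by (simp add: circ_edges_def)
    have "p \<notin> {u. (u, p) \<in> ?E\<^sup>+}" using ac by (simp add: acyclic_def)
    moreover have "{u. (u, p) \<in> ?E\<^sup>+} \<subseteq> {u. (u, v) \<in> ?E\<^sup>+}" using e by (auto intro: trancl_into_trancl)
    moreover have "p \<in> {u. (u, v) \<in> ?E\<^sup>+}" using e by auto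
    ultimately have "{u. (u, p) \<in> ?E\<^sup>+} \<subset> {u. (u, v) \<in> ?E\<^sup>+}" by blast
    then show ?thesis by (rule psubset_card_mono[OF fin])
  qed
  ultimately show ?thesis by (intro exI[of _ ?r]) simp
qed

lemma net_of_rank:
  fixes r :: "nat \<Rightarrow> nat"
  assumes "\<And>v i. v < length vs \<Longrightarrow> vs ! v = Inp i \<Longrightarrow> i < n"
    and "\<And>v p. v < length vs \<Longrightarrow> p \<in> parents (vs ! v) \<Longrightarrow> p < length vs \<and> r p < r v"
  shows "net n vs"
proof -
  have "circ_edges vs \<subseteq> Wellfounded.measure r" using assms(2) by (auto simp: circ_edges_def)
  then have "acyclic (circ_edges vs)" by (rule wf_acyclic[OF wf_subset[OF wf_measure]])
  then show ?thesis using assms by (auto simp: net_def in_set_conv_nth)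
qed

text \<open>A semantics without fuel: acyclicity leaves exactly one assignment on the vertices, and
  \<open>ev\<close> with enough fuel computes it. For a composed circuit it can be written down from
  those of the parts, whatever fuel these need.\<close>

definition assignment :: "vtx list \<Rightarrow> bool list \<Rightarrow> (nat \<Rightarrow> bool) \<Rightarrow> bool" where
  "assignment vs x \<rho> \<longleftrightarrow> (\<forall>v < length vs. \<rho> v = gate_val (vs ! v) x \<rho>)"

lemma ev_eq_assignment:
  assumes net: "net n vs" and \<rho>: "assignment vs x \<rho>" and "v < length vs" "length vs \<le> k"
  shows "ev k vs x v = \<rho> v"
proof -
  obtain r :: "nat \<Rightarrow> nat" where r1: "\<And>v. v < length vs \<Longrightarrow> r v < length vs"
    and r2: "\<And>v p. v < length vs \<Longrightarrow> p \<in> parents (vs ! v) \<Longrightarrow> r p < r v"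
    using net_rank[OF net] by metis
  \<comment> \<open>Fuel above the rank is enough, since parents have smaller rank.\<close>
  have "v < length vs \<Longrightarrow> r v < k \<Longrightarrow> ev k vs x v = \<rho> v" for k v
  proof (induction k arbitrary: v)
    case (Suc k)
    have "gate_val (vs ! v) x (ev k vs x) = gate_val (vs ! v) x \<rho>"
      by (rule gate_val_cong, rule Suc.IH) (use Suc.prems net_parents[OF net] r2 in \<open>force+\<close>)
    then show ?case using \<rho> Suc.prems by (simp add: ev_Suc assignment_def del: ev.simps)
  qed simp
  then show ?thesis using assms r1[of v] by auto
qed

lemma assignment_ev:
  assumes net: "net n vs"
  shows "assignment vs x (ev (length vs) vs x)"
proof -
  obtain r :: "nat \<Rightarrow> nat" where r1: "\<And>v. v < length vs \<Longrightarrow> r v < length vs"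
    and r2: "\<And>v p. v < length vs \<Longrightarrow> p \<in> parents (vs ! v) \<Longrightarrow> r p < r v"
    using net_rank[OF net] by metis
  \<comment> \<open>Beyond the rank, one more unit of fuel changes nothing, so the values at fuel
    \<open>length vs\<close> satisfy the gate equations.\<close>
  have stable: "v < length vs \<Longrightarrow> r v < k \<Longrightarrow> ev (Suc k) vs x v = ev k vs x v" for k v
  proof (induction k arbitrary: v)
    case (Suc k)
    have "gate_val (vs ! v) x (ev (Suc k) vs x) = gate_val (vs ! v) x (ev k vs x)"
      by (rule gate_val_cong, rule Suc.IH) (use Suc.prems net_parents[OF net] r2 in \<open>force+\<close>)
    then show ?case by (simp only: ev_Suc)
  qed simp
  show ?thesis
    unfolding assignment_def
  proof (intro allI impI)
    fix v assume v: "v < length vs"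
    have "ev (length vs) vs x v = ev (Suc (length vs)) vs x v"
      using stable[OF v r1[OF v]] by simp
    then show "ev (length vs) vs x v = gate_val (vs ! v) x (ev (length vs) vs x)"
      by (simp only: ev_Suc)
  qed
qed

lemma circ_eval_assignment:
  assumes "net n vs" "sinks vs = {out}" "assignment vs x \<rho>"
  shows "circ_eval vs x = \<rho> out"
proof -
  have "out < length vs" using assms(2) by (auto simp: sinks_def)
  then show ?thesis
    unfolding circ_eval_def using assms ev_eq_assignment[OF assms(1,3), of out] by simp
qed

section \<open>Disjoint unions of circuits and attaching an output gate\<close>

fun shift :: "nat \<Rightarrow> vtx \<Rightarrow> vtx" where
  "shift k (Inp i) = Inp i"
| "shift k (And a b) = And (k + a) (k + b)"
| "shift k (Or a b) = Or (k + a) (k + b)"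
| "shift k (Not a) = Not (k + a)"

lemma parents_shift [simp]: "parents (shift k g) = (+) k ` parents g"
  by (cases g) (auto simp: parents_def)

lemma shift_eq_Inp [simp]: "shift k g = Inp i \<longleftrightarrow> g = Inp i"
  by (cases g) auto

lemma gate_val_shift [simp]: "gate_val (shift k g) x \<rho> = gate_val g x (\<lambda>v. \<rho> (k + v))"
  by (cases g) (auto simp: gate_val_def)

definition juxt :: "vtx list \<Rightarrow> vtx list \<Rightarrow> vtx list" where
  "juxt vs ws = vs @ map (shift (length vs)) ws"

lemma length_juxt [simp]: "length (juxt vs ws) = length vs + length ws"
  by (simp add: juxt_def)

lemma nth_juxt:
  "v < length vs \<Longrightarrow> juxt vs ws ! v = vs ! v"
  "v < length ws \<Longrightarrow> juxt vs ws ! (length vs + v) = shift (length vs) (ws ! v)"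
  by (auto simp: juxt_def nth_append)

lemma nat_less_add_cases:
  fixes v :: nat
  assumes "v < a + b"
  obtains "v < a" | w where "w < b" "v = a + w"
  using assms by (metis add_less_cancel_left le_Suc_ex not_le)

lemma net_juxt:
  assumes "net n vs" "net n ws"
  shows "net n (juxt vs ws)"
proof -
  obtain r :: "nat \<Rightarrow> nat" where r: "\<And>v p. v < length vs \<Longrightarrow> p \<in> parents (vs ! v) \<Longrightarrow> r p < r v"
    using net_rank[OF assms(1)] by metis
  obtain r' :: "nat \<Rightarrow> nat" where r': "\<And>v p. v < length ws \<Longrightarrow> p \<in> parents (ws ! v) \<Longrightarrow> r' p < r' v"
    using net_rank[OF assms(2)] by metis
  show ?thesis
  proof (rule net_of_rank[where r = "\<lambda>v. if v < length vs then r v else r' (v - length vs)"])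
    fix v i assume "v < length (juxt vs ws)" "juxt vs ws ! v = Inp i"
    then show "i < n"
      using assms by (auto elim!: nat_less_add_cases simp: nth_juxt dest: net_inputs)
  next
    fix v p assume "v < length (juxt vs ws)" "p \<in> parents (juxt vs ws ! v)"
    then show "p < length (juxt vs ws) \<and>
        (if p < length vs then r p else r' (p - length vs)) < (if v < length vs then r v else r' (v - length vs))"
      using net_parents[OF assms(1)] net_parents[OF assms(2)] r r'
      by (auto elim!: nat_less_add_cases simp: nth_juxt less_imp_le trans_less_add1)
  qed
qed

lemma sinks_juxt:
  assumes "net n vs" "net n ws"
  shows "sinks (juxt vs ws) = sinks vs \<union> (+) (length vs) ` sinks ws"
proof (intro equalityI subsetI)
  fix v assume v: "v \<in> sinks (juxt vs ws)"
  then have *: "v < length vs + length ws" "\<And>u. u < length vs + length ws \<Longrightarrow> v \<notin> parents (juxt vs ws ! u)"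
    by (auto simp: sinks_def)
  from *(1) show "v \<in> sinks vs \<union> (+) (length vs) ` sinks ws"
  proof (cases rule: nat_less_add_cases)
    case 1
    then have "v \<in> sinks vs" using *(2) by (auto simp: sinks_def) (metis nth_juxt(1) trans_less_add1)
    then show ?thesis by simp
  next
    case (2 w)
    have "w \<notin> parents (ws ! u)" if "u < length ws" for u
      using *(2)[of "length vs + u"] that 2 by (auto simp: nth_juxt)
    then show ?thesis using 2 by (auto simp: sinks_def)
  qed
next
  fix v assume "v \<in> sinks vs \<union> (+) (length vs) ` sinks ws"
  then show "v \<in> sinks (juxt vs ws)"
    using net_parents[OF assms(1)]
    by (auto simp: sinks_def nth_juxt elim!: nat_less_add_cases) (metis not_add_less1)
qed

lemma assignment_juxt:
  assumes "net n vs" "net n ws" "assignment vs x \<rho>" "assignment ws x \<rho>'"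
  shows "assignment (juxt vs ws) x (\<lambda>v. if v < length vs then \<rho> v else \<rho>' (v - length vs))"
  unfolding assignment_def
proof (intro allI impI)
  let ?r = "\<lambda>v. if v < length vs then \<rho> v else \<rho>' (v - length vs)"
  fix v assume "v < length (juxt vs ws)"
  then have "v < length vs + length ws" by simp
  then show "?r v = gate_val (juxt vs ws ! v) x ?r"
  proof (cases rule: nat_less_add_cases)
    case 1
    have "gate_val (vs ! v) x ?r = gate_val (vs ! v) x \<rho>"
      by (rule gate_val_cong) (use net_parents[OF assms(1) 1] in auto)
    then show ?thesis using 1 assms(3) by (simp add: nth_juxt assignment_def)
  next
    case (2 w)
    then show ?thesis using assms(4) by (simp add: nth_juxt assignment_def)
  qed
qed

lemma net_snoc:
  assumes "net n vs" "parents g \<subseteq> {..<length vs}" "\<And>i. g = Inp i \<Longrightarrow> i < n"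
  shows "net n (vs @ [g])"
proof -
  obtain r :: "nat \<Rightarrow> nat" where
    r: "\<And>v. v < length vs \<Longrightarrow> r v < length vs"
    "\<And>v p. v < length vs \<Longrightarrow> p \<in> parents (vs ! v) \<Longrightarrow> r p < r v"
    using net_rank[OF assms(1)] by metis
  show ?thesis
  proof (rule net_of_rank[where r = "r(length vs := length vs)"])
    fix v i assume "v < length (vs @ [g])" "(vs @ [g]) ! v = Inp i"
    then show "i < n"
      using assms(3) net_inputs[OF assms(1)] by (auto simp: nth_append split: if_splits)
  next
    fix v p assume "v < length (vs @ [g])" "p \<in> parents ((vs @ [g]) ! v)"
    then show "p < length (vs @ [g]) \<and> (r(length vs := length vs)) p < (r(length vs := length vs)) v"
    proof (cases "v = length vs")
      case True
      then show ?thesis using \<open>p \<in> _\<close> assms(2) r(1) by auto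
    next
      case False
      then have "v < length vs" "p \<in> parents (vs ! v)"
        using \<open>p \<in> _\<close> \<open>v < _\<close> by (auto simp: nth_append)
      then show ?thesis using net_parents[OF assms(1)] r(2) False by fastforce
    qed
  qed
qed

text \<open>Since the parents of g are exactly the old sinks, g becomes the only sink. This covers
  input vertices (empty net), negations (one sink) and binary gates (the two sinks of a
  juxtaposition) at once.\<close>

lemma circuit_snoc:
  assumes "net n vs" "parents g = sinks vs" "\<And>i. g = Inp i \<Longrightarrow> i < n" "n \<ge> 1"
  shows "valid_circuit n (vs @ [g])"
    and "assignment vs x \<rho> \<Longrightarrow> circ_eval (vs @ [g]) x = gate_val g x \<rho>"
proof -
  have sub: "parents g \<subseteq> {..<length vs}" using assms(2) by (auto simp: sinks_def)
  have net: "net n (vs @ [g])" using net_snoc[OF assms(1) sub assms(3)] .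
  have sinks: "sinks (vs @ [g]) = {length vs}"
  proof (intro equalityI subsetI)
    fix v assume "v \<in> sinks (vs @ [g])"
    then have *: "v \<le> length vs" "\<And>u. u \<le> length vs \<Longrightarrow> v \<notin> parents ((vs @ [g]) ! u)"
      by (auto simp: sinks_def less_Suc_eq_le)
    have "v \<notin> parents g" using *(2)[of "length vs"] by simp
    then have "v \<notin> sinks vs" using assms(2) by simp
    moreover have "v \<notin> parents (vs ! u)" if "u < length vs" for u
      using *(2)[of u] that by (simp add: nth_append)
    ultimately show "v \<in> {length vs}" using *(1) by (auto simp: sinks_def)
  next
    fix v assume "v \<in> {length vs}"
    then show "v \<in> sinks (vs @ [g])"
      using sub net_parents[OF assms(1)] by (auto simp: sinks_def nth_append less_Suc_eq)
  qed
  show "valid_circuit n (vs @ [g])"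
    using net sinks assms(4) by (simp add: valid_circuit_net)
  assume \<rho>: "assignment vs x \<rho>"
  let ?r = "\<rho>(length vs := gate_val g x \<rho>)"
  have g: "gate_val g x ?r = gate_val g x \<rho>"
    by (rule gate_val_cong) (use sub in auto)
  have "gate_val (vs ! v) x ?r = gate_val (vs ! v) x \<rho>" if "v < length vs" for v
    by (rule gate_val_cong) (use net_parents[OF assms(1) that] in auto)
  then have "assignment (vs @ [g]) x ?r"
    using \<rho> g by (auto simp: assignment_def nth_append less_Suc_eq)
  from circ_eval_assignment[OF net sinks this]
  show "circ_eval (vs @ [g]) x = gate_val g x \<rho>" by simp
qed

section \<open>Functions with a circuit of bounded size\<close>

definition has_circ :: "nat \<Rightarrow> nat \<Rightarrow> (bool list \<Rightarrow> bool) \<Rightarrow> bool" where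
  "has_circ n s F \<longleftrightarrow> (\<exists>vs. length vs \<le> s \<and> circ_computes n vs F)"

lemma has_circ_mono: "has_circ n s F \<Longrightarrow> s \<le> s' \<Longrightarrow> has_circ n s' F"
  unfolding has_circ_def using le_trans by blast

lemma has_circ_cong:
  assumes "has_circ n s F" "\<And>x. length x = n \<Longrightarrow> F x = G x"
  shows "has_circ n s G"
  using assms unfolding has_circ_def circ_computes_def by metis

lemma has_circ_Inp:
  assumes "i < n"
  shows "has_circ n 1 (\<lambda>x. x ! i)"
proof -
  have net: "net n []" by (rule net_of_rank) auto
  have "valid_circuit n ([] @ [Inp i])"
    by (rule circuit_snoc(1)[OF net]) (use assms in \<open>auto simp: parents_def sinks_def\<close>)
  moreover have "circ_eval ([] @ [Inp i]) x = gate_val (Inp i) x (\<lambda>_. False)" for x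
    by (rule circuit_snoc(2)[OF net]) (use assms in \<open>auto simp: parents_def sinks_def assignment_def\<close>)
  ultimately show ?thesis
    unfolding has_circ_def circ_computes_def gate_val_def by (intro exI[of _ "[Inp i]"]) simp
qed

lemma valid_circuit_sink:
  assumes "valid_circuit n vs"
  obtains out where "net n vs" "sinks vs = {out}" "n \<ge> 1"
    "\<And>x. circ_eval vs x = ev (length vs) vs x out"
  using assms by (auto simp: valid_circuit_net card_1_singleton_iff circ_eval_def)

lemma has_circ_Not:
  assumes "has_circ n s F"
  shows "has_circ n (Suc s) (\<lambda>x. \<not> F x)"
proof -
  obtain vs where vs: "length vs \<le> s" "valid_circuit n vs" "\<And>x. length x = n \<Longrightarrow> circ_eval vs x = F x"
    using assms by (auto simp: has_circ_def circ_computes_def)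
  obtain out where o: "net n vs" "sinks vs = {out}" "n \<ge> 1"
    and e: "\<And>x. circ_eval vs x = ev (length vs) vs x out"
    using valid_circuit_sink[OF vs(2)] by metis
  have p: "parents (Not out) = sinks vs" using o by (simp add: parents_def)
  have "valid_circuit n (vs @ [Not out])"
    by (rule circuit_snoc(1)[OF o(1) p _ o(3)]) simp
  moreover have "circ_eval (vs @ [Not out]) x = (\<not> circ_eval vs x)" for x
    using circuit_snoc(2)[OF o(1) p _ o(3) assignment_ev[OF o(1)]] e by (simp add: gate_val_def)
  ultimately show ?thesis
    unfolding has_circ_def circ_computes_def using vs by (intro exI[of _ "vs @ [Not out]"]) simp
qed

text \<open>Both operands are copied without sharing, so sizes add even if F and G agree, and the
  two sinks of the juxtaposition are always distinct.\<close>

lemma has_circ_binary: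
  assumes "has_circ n s F" "has_circ n t G"
    and gate: "\<And>a b. parents (gt a b) = {a, b}" "\<And>a b x \<rho>. gate_val (gt a b) x \<rho> = bop (\<rho> a) (\<rho> b)"
  shows "has_circ n (Suc (s + t)) (\<lambda>x. bop (F x) (G x))"
proof -
  obtain vs where vs: "length vs \<le> s" "valid_circuit n vs" "\<And>x. length x = n \<Longrightarrow> circ_eval vs x = F x"
    using assms(1) by (auto simp: has_circ_def circ_computes_def)
  obtain ws where ws: "length ws \<le> t" "valid_circuit n ws" "\<And>x. length x = n \<Longrightarrow> circ_eval ws x = G x"
    using assms(2) by (auto simp: has_circ_def circ_computes_def)
  obtain a where a: "net n vs" "sinks vs = {a}" "n \<ge> 1"
    and ea: "\<And>x. circ_eval vs x = ev (length vs) vs x a"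
    using valid_circuit_sink[OF vs(2)] by metis
  obtain b where b: "net n ws" "sinks ws = {b}"
    and eb: "\<And>x. circ_eval ws x = ev (length ws) ws x b"
    using valid_circuit_sink[OF ws(2)] by metis
  have la: "a < length vs" using a(2) by (auto simp: sinks_def)
  let ?c = "juxt vs ws" and ?g = "gt a (length vs + b)"
  have net: "net n ?c" using net_juxt a b by simp
  have p: "parents ?g = sinks ?c" using sinks_juxt[OF a(1) b(1)] a(2) b(2) gate(1) by auto
  have ni: "?g \<noteq> Inp i" for i using gate(1)[of a "length vs + b"] by (auto simp: parents_def)
  have "valid_circuit n (?c @ [?g])"
    by (rule circuit_snoc(1)[OF net p _ a(3)]) (simp add: ni)
  moreover have "circ_eval (?c @ [?g]) x = bop (circ_eval vs x) (circ_eval ws x)" for x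
    using circuit_snoc(2)[OF net p _ a(3)
        assignment_juxt[OF a(1) b(1) assignment_ev[OF a(1)] assignment_ev[OF b(1)]]] ni la
    by (simp add: gate(2) ea eb)
  ultimately show ?thesis
    unfolding has_circ_def circ_computes_def using vs ws
    by (intro exI[of _ "?c @ [?g]"]) simp
qed

lemma has_circ_And:
  "has_circ n s F \<Longrightarrow> has_circ n t G \<Longrightarrow> has_circ n (Suc (s + t)) (\<lambda>x. F x \<and> G x)"
  by (rule has_circ_binary[where gt = And]) (auto simp: parents_def gate_val_def)

lemma has_circ_Or:
  "has_circ n s F \<Longrightarrow> has_circ n t G \<Longrightarrow> has_circ n (Suc (s + t)) (\<lambda>x. F x \<or> G x)"
  by (rule has_circ_binary[where gt = Or]) (auto simp: parents_def gate_val_def)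

text \<open>There are n literals of at most two vertices each, joined by n - 1 conjunctions. The
  induction starts at k = 1 because an empty conjunction would require a constant gate.\<close>

lemma has_circ_eq_point:
  assumes "n \<ge> 1" "length z = n"
  shows "has_circ n (3 * n) (\<lambda>x. x = z)"
proof -
  have lit: "has_circ n 2 (\<lambda>x. x ! i = z ! i)" if "i < n" for i
  proof (cases "z ! i")
    case True
    then show ?thesis using has_circ_mono[OF has_circ_Inp[OF that], of 2] by simp
  next
    case False
    then show ?thesis using has_circ_Not[OF has_circ_Inp[OF that]] by (simp add: numeral_2_eq_2)
  qed
  have "has_circ n (3 * k) (\<lambda>x. \<forall>i<k. x ! i = z ! i)" if "1 \<le> k" "k \<le> n" for k
    using that
  proof (induction k rule: dec_induct)
    case base
    have "has_circ n 3 (\<lambda>x. x ! 0 = z ! 0)" by (rule has_circ_mono[OF lit]) (use assms in auto)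
    then show ?case by simp
  next
    case (step k)
    have "has_circ n (Suc (3 * k + 2)) (\<lambda>x. (\<forall>i<k. x ! i = z ! i) \<and> x ! k = z ! k)"
      by (rule has_circ_And[OF step.IH lit]) (use step in auto)
    then show ?case by (rule has_circ_cong[OF has_circ_mono]) (auto simp: less_Suc_eq)
  qed
  from this[OF assms(1) order_refl] show ?thesis
    by (rule has_circ_cong) (auto simp: assms(2) list_eq_iff_nth_eq)
qed

lemma has_circ_member:
  assumes "n \<ge> 1" "\<forall>z \<in> set zs. length z = n"
  shows "has_circ n (4 + (3 * n + 1) * length zs) (\<lambda>x. x \<in> set zs)"
  using assms(2)
proof (induction zs)
  case Nil
  \<comment> \<open>In the absence of constant gates the empty table is a contradiction on input 0,
    at the price of 1 + 2 + 1 = 4 vertices.\<close>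
  have i: "has_circ n 1 (\<lambda>x. x ! 0)" by (rule has_circ_Inp) (use assms in simp)
  have "has_circ n 4 (\<lambda>x. x ! 0 \<and> \<not> x ! 0)"
    using has_circ_And[OF i has_circ_Not[OF i]] by (simp add: numeral_eq_Suc)
  then show ?case by simp
next
  case (Cons z zs)
  have "has_circ n (Suc (3 * n + (4 + (3 * n + 1) * length zs))) (\<lambda>x. x = z \<or> x \<in> set zs)"
    by (rule has_circ_Or[OF has_circ_eq_point[OF assms(1)] Cons.IH]) (use Cons.prems in auto)
  then show ?case by (rule has_circ_cong[OF has_circ_mono]) auto
qed

text \<open>In this form of majority F and G occur twice and H once: five copies and four
  gates.\<close>

lemma has_circ_maj3:
  assumes "has_circ n s F" "has_circ n s G" "has_circ n s H"
  shows "has_circ n (5 * s + 4) (\<lambda>x. F x \<and> G x \<or> H x \<and> (F x \<or> G x))"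
  by (rule has_circ_mono[OF has_circ_Or[OF has_circ_And[OF assms(1,2)]
        has_circ_And[OF assms(3) has_circ_Or[OF assms(1,2)]]]]) simp

fun ren_inp :: "(nat \<Rightarrow> nat) \<Rightarrow> vtx \<Rightarrow> vtx" where
  "ren_inp r (Inp i) = Inp (r i)"
| "ren_inp r g = g"

lemma parents_ren_inp [simp]: "parents (ren_inp r g) = parents g"
  by (cases g) (auto simp: parents_def)

lemma circ_edges_ren_inp [simp]: "circ_edges (map (ren_inp r) vs) = circ_edges vs"
  by (auto simp: circ_edges_def)

lemma sinks_ren_inp [simp]: "sinks (map (ren_inp r) vs) = sinks vs"
  by (auto simp: sinks_def)

lemma ev_ren_inp:
  assumes "net n vs" "v < length vs" "\<And>i. i < n \<Longrightarrow> y ! i = x ! r i"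
  shows "ev k (map (ren_inp r) vs) x v = ev k vs y v"
  using assms(2)
proof (induction k arbitrary: v)
  case (Suc k)
  then show ?case
    using assms(3) net_inputs[OF assms(1) Suc.prems] net_parents[OF assms(1) Suc.prems]
    by (cases "vs ! v") (auto simp: parents_def)
qed simp

lemma has_circ_ren_inp:
  assumes "has_circ n s F" "\<And>i. i < n \<Longrightarrow> r i < l" "l \<ge> 1"
    and "\<And>x. length x = l \<Longrightarrow> G x = F (map (\<lambda>i. x ! r i) [0..<n])"
  shows "has_circ l s G"
proof -
  obtain vs where vs: "length vs \<le> s" "valid_circuit n vs" "\<And>x. length x = n \<Longrightarrow> circ_eval vs x = F x"
    using assms(1) by (auto simp: has_circ_def circ_computes_def)
  obtain a where a: "net n vs" "sinks vs = {a}"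
    and ea: "\<And>x. circ_eval vs x = ev (length vs) vs x a"
    using valid_circuit_sink[OF vs(2)] by metis
  have la: "a < length vs" using a(2) by (auto simp: sinks_def)
  have inp: "i < l" if "v \<in> set vs" "ren_inp r v = Inp i" for v i
    using a(1) that assms(2) by (cases v) (auto simp: net_def)
  have "net l (map (ren_inp r) vs)"
    using a(1) inp by (auto simp: net_def)
  then have "valid_circuit l (map (ren_inp r) vs)"
    using a(2) assms(3) vs(2) by (simp add: valid_circuit_net)
  moreover have "circ_eval (map (ren_inp r) vs) x = G x" if "length x = l" for x
  proof -
    have "circ_eval (map (ren_inp r) vs) x = ev (length vs) (map (ren_inp r) vs) x a"
      by (simp add: circ_eval_def a(2))
    also have "\<dots> = ev (length vs) vs (map (\<lambda>i. x ! r i) [0..<n]) a"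
      by (rule ev_ren_inp[OF a(1) la]) simp
    also have "\<dots> = G x" using vs(3) ea assms(4)[OF that] by simp
    finally show ?thesis .
  qed
  ultimately show ?thesis
    unfolding has_circ_def circ_computes_def using vs(1) by (intro exI[of _ "map (ren_inp r) vs"]) simp
qed

section \<open>Circuit encodings\<close>

lemma clog_bound: "n \<le> 2 ^ clog n"
  unfolding clog_def by (rule LeastI[of _ n]) (simp add: less_imp_le)

lemma clog_mono: "m \<le> n \<Longrightarrow> clog m \<le> clog n"
  unfolding clog_def[of m] by (rule Least_le) (use clog_bound[of n] in linarith)

lemma length_bits [simp]: "length (bits k v) = k"
  by (simp add: bits_def)

lemma bits_inject:
  assumes "bits k v = bits k w" "v < 2 ^ k" "w < 2 ^ k"
  shows "v = w"
proof (rule bit_eqI)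
  fix i :: nat
  show "bit v i = bit w i"
  proof (cases "i < k")
    case True
    then have "bits k v ! (k - 1 - i) = bits k w ! (k - 1 - i)" using assms(1) by simp
    then show ?thesis using True by (simp add: bits_def bit_iff_odd)
  next
    case False
    then have "2 ^ k \<le> (2::nat) ^ i" by (intro power_increasing) auto
    then have "v < 2 ^ i" "w < 2 ^ i" using assms(2,3) by linarith+
    then show ?thesis by (simp add: bit_iff_odd)
  qed
qed

lemma bits_eq: "v < 2 ^ k \<Longrightarrow> w < 2 ^ k \<Longrightarrow> bits k v = bits k w \<longleftrightarrow> v = w"
  using bits_inject by blast

lemma length_venc: "length (venc n s v) = 2 + max (2 * clog s) (clog n)"
  by (cases v) (auto simp: venc_def Let_def)

lemma length_concat_const: "(\<And>v. v \<in> set vs \<Longrightarrow> length (f v) = k) \<Longrightarrow> length (concat (map f vs)) = length vs * k"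
  by (induction vs) auto

lemma length_circ_enc:
  "length (circ_enc n vs) =
     2 * clog n + 2 + length vs * (3 + max (2 * clog (length vs)) (clog n))"
  unfolding circ_enc_def
  by (simp add: length_concat_const[OF length_venc] algebra_simps)

text \<open>For fixed n the code length increases strictly with the number of vertices, so
  minimizing program length amounts to minimizing circuit size.\<close>

lemma length_circ_enc_le_imp:
  assumes "length (circ_enc n vs) \<le> length (circ_enc n ws)"
  shows "length vs \<le> length ws"
proof (rule ccontr)
  assume "\<not> length vs \<le> length ws"
  then have "length ws < length vs" by simp
  moreover have "3 + max (2 * clog (length ws)) (clog n) \<le> 3 + max (2 * clog (length vs)) (clog n)"
    using clog_mono[of "length ws" "length vs"] calculation by (intro add_left_mono max.mono) auto
  ultimately have "length ws * (3 + max (2 * clog (length ws)) (clog n))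
      < length vs * (3 + max (2 * clog (length vs)) (clog n))"
    by (intro mult_less_le_imp_less) auto
  then show False using assms unfolding length_circ_enc by linarith
qed

lemma replicate_delim_inject:
  "replicate k a @ b # xs = replicate l a @ b # ys \<Longrightarrow> a \<noteq> b \<Longrightarrow> k = l \<and> xs = ys"
proof (induction k arbitrary: l)
  case 0
  then show ?case by (cases l) auto
next
  case (Suc k)
  then show ?case by (cases l) auto
qed

lemma venc_inject:
  assumes "venc n s v = venc n s w"
    and "\<And>i. v = Inp i \<Longrightarrow> i < n" "\<And>p. p \<in> parents v \<Longrightarrow> p < s"
    and "\<And>i. w = Inp i \<Longrightarrow> i < n" "\<And>p. p \<in> parents w \<Longrightarrow> p < s"
  shows "v = w"
proof -
  let ?w = "max (2 * clog s) (clog n)"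
  have inp: "i < 2 ^ ?w" if "i < n" for i
  proof -
    have "i < 2 ^ clog n" using that clog_bound[of n] by linarith
    also have "\<dots> \<le> 2 ^ ?w" by (intro power_increasing) auto
    finally show ?thesis .
  qed
  have par: "p < 2 ^ clog s" if "p < s" for p
    using that clog_bound[of s] by linarith
  show ?thesis
    using assms by (cases v; cases w) (simp_all add: venc_def Let_def parents_def bits_eq inp par)
qed

lemma concat_map_inject:
  assumes "concat (map f vs) = concat (map f ws)" "length vs = length ws"
    and "\<And>v w. v \<in> set vs \<Longrightarrow> w \<in> set ws \<Longrightarrow> f v = f w \<Longrightarrow> v = w"
    and "\<And>v. length (f v) = k"
  shows "vs = ws"
  using assms(2,1,3)
  by (induction vs ws rule: list_induct2) (auto simp: assms(4))

text \<open>The word parses from left to right: the unary prefix gives the width of the block for n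
  - 1 (n itself may equal \<open>2 ^ clog n\<close> and would not fit), and the second unary block
  gives the number of vertices and thereby the width of each vertex code. Hence the
  \<open>SOME\<close> in \<open>circuit_interp\<close> recovers the encoded circuit.\<close>

lemma circ_enc_inject:
  assumes "circ_enc m vs = circ_enc n ws" "valid_circuit m vs" "valid_circuit n ws"
  shows "m = n \<and> vs = ws"
proof -
  have mn: "m \<ge> 1" "n \<ge> 1" using assms by (auto simp: valid_circuit_def)
  have c: "clog m = clog n" and
    d: "bits (clog m) (m - 1) @ replicate (length vs) False @ True # concat (map (venc m (length vs)) vs)
     = bits (clog n) (n - 1) @ replicate (length ws) False @ True # concat (map (venc n (length ws)) ws)"
    using replicate_delim_inject[OF assms(1)[unfolded circ_enc_def append_assoc append.simps]] by blast+
  have b: "bits (clog n) (m - 1) = bits (clog n) (n - 1)"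
    and r: "replicate (length vs) False @ True # concat (map (venc m (length vs)) vs)
     = replicate (length ws) False @ True # concat (map (venc n (length ws)) ws)"
    using d[unfolded c] by simp_all
  have "m - 1 < 2 ^ clog n" "n - 1 < 2 ^ clog n"
    using clog_bound[of m] clog_bound[of n] mn c by auto
  then have "m - 1 = n - 1" using bits_inject[OF b] by simp
  then have e: "m = n" using mn by simp
  have l: "length vs = length ws"
    and cc: "concat (map (venc n (length ws)) vs) = concat (map (venc n (length ws)) ws)"
    using replicate_delim_inject[OF r] e by auto
  have "vs = ws"
  proof (rule concat_map_inject[OF cc l])
    fix v w assume "v \<in> set vs" "w \<in> set ws" "venc n (length ws) v = venc n (length ws) w"
    then show "v = w"
      using assms(2,3) e l by (intro venc_inject[of n "length ws" v w]) (auto simp: valid_circuit_def)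
  qed (simp add: length_venc)
  then show ?thesis using e by simp
qed

lemma circuit_interp_enc:
  assumes "valid_circuit n vs" "length x = n"
  shows "circuit_interp (circ_enc n vs) x = Some (circ_eval vs x)"
proof -
  have "(SOME ws. \<exists>m. valid_circuit m ws \<and> circ_enc m ws = circ_enc n vs) = vs"
  proof (rule some_equality)
    show "\<exists>m. valid_circuit m vs \<and> circ_enc m vs = circ_enc n vs" using assms by blast
    fix ws assume "\<exists>m. valid_circuit m ws \<and> circ_enc m ws = circ_enc n vs"
    then obtain m where m: "valid_circuit m ws" "circ_enc m ws = circ_enc n vs" by blast
    show "ws = vs" using circ_enc_inject[OF m(2,1) assms(1)] by simp
  qed
  then show ?thesis using assms unfolding circuit_interp_def by auto
qed

lemma circuit_interp_not_None:
  assumes "circuit_interp h x \<noteq> None"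
  obtains vs where "valid_circuit (length x) vs" "h = circ_enc (length x) vs"
  using assms unfolding circuit_interp_def by (auto split: if_splits)

section \<open>Boosting and hard distributions\<close>

lemma finite_cube: "finite {x :: bool list. length x = n}"
  using finite_lists_length_eq[of "UNIV :: bool set" n] by simp

definition err :: "nat \<Rightarrow> (bool list \<Rightarrow> bool) \<Rightarrow> (bool list \<Rightarrow> real) \<Rightarrow> (bool list \<Rightarrow> bool) \<Rightarrow> real" where
  "err n f w F = (\<Sum>x | length x = n \<and> F x \<noteq> f x. w x)"

definition mass :: "nat \<Rightarrow> (bool list \<Rightarrow> real) \<Rightarrow> real" where
  "mass n w = (\<Sum>x | length x = n. w x)"

text \<open>Weights are not normalized, so the reweightings made by boosting are admissible even
  when their total mass is 0.\<close>

definition weakly_learnable :: "nat \<Rightarrow> (bool list \<Rightarrow> bool) \<Rightarrow> nat \<Rightarrow> real \<Rightarrow> bool" where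
  "weakly_learnable n f s e \<longleftrightarrow>
     (\<forall>w. (\<forall>x. w x \<ge> 0) \<longrightarrow> (\<exists>F. has_circ n s F \<and> err n f w F \<le> e * mass n w))"

lemma err_eq: "err n f w F = (\<Sum>x | length x = n. if F x \<noteq> f x then w x else 0)"
  unfolding err_def using sum.inter_filter[OF finite_cube[of n], of w "\<lambda>x. F x \<noteq> f x"] by simp

text \<open>A and B are the masses where the first hypothesis is wrong and right, u and v the parts
  of them where the second is wrong. Eliminating v leaves u with the coefficient (A - e * (A + B)) /
  A, which is not positive, and the remainder e * A + 2 * e^2 * B is at most 3 * e^2 * (A +
  B).\<close>

lemma boost_ineq:
  fixes A B u v e :: real
  assumes "A > 0" "0 \<le> u" "0 \<le> e" "A \<le> e * (A + B)" "B * u + A * v \<le> e * (2 * A * B)"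
  shows "u + e * (A - u + v) \<le> 3 * e^2 * (A + B)"
proof -
  have "v \<le> 2 * e * B - B * u / A"
    using assms(1,5) by (simp add: field_simps)
  then have "e * v \<le> e * (2 * e * B - B * u / A)" using assms(3) by (rule mult_left_mono)
  then have "u + e * (A - u + v) \<le> e * A + 2 * e^2 * B + u * ((A * (1 - e) - e * B) / A)"
    using assms(1) by (simp add: field_simps power2_eq_square)
  also have "u * ((A * (1 - e) - e * B) / A) \<le> 0"
    using assms by (intro mult_nonneg_nonpos divide_nonpos_pos) (auto simp: algebra_simps)
  also have "e * A \<le> e * (e * (A + B))" using assms(3,4) by (intro mult_left_mono) auto
  also have "2 * e^2 * B \<le> 2 * e^2 * (A + B)" using assms(1) by (intro mult_left_mono) auto
  finally show ?thesis by (simp add: algebra_simps power2_eq_square)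
qed

text \<open>The second hypothesis sees weights under which the first is no better than a coin,
  the third one only the points where the first two disagree.\<close>
lemma boost_step:
  assumes wl: "weakly_learnable n f s e" and "0 \<le> e" "e < 1"
  shows "weakly_learnable n f (5 * s + 4) (3 * e^2)"
  unfolding weakly_learnable_def
proof (intro allI impI)
  fix w :: "bool list \<Rightarrow> real" assume w: "\<forall>x. w x \<ge> 0"
  have wl': "\<exists>F. has_circ n s F \<and> err n f u F \<le> e * mass n u" if "\<And>x. u x \<ge> 0" for u
    using wl that unfolding weakly_learnable_def by blast
  have nn: "err n f u F \<ge> 0" if "\<And>x. u x \<ge> 0" for u F
    unfolding err_def using that by (intro sum_nonneg) auto
  have mm: "mass n u \<ge> 0" if "\<And>x. u x \<ge> 0" for u
    unfolding mass_def using that by (intro sum_nonneg) auto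
  obtain F where F: "has_circ n s F" "err n f w F \<le> e * mass n w"
    using wl'[of w] w by blast
  define A where "A = err n f w F"
  define B where "B = mass n w - A"
  have B: "B = (\<Sum>x | length x = n. if F x = f x then w x else 0)"
    unfolding B_def A_def mass_def err_eq sum_subtractf[symmetric] by (intro sum.cong) auto
  have A0: "A \<ge> 0" unfolding A_def using nn w by blast
  have B0: "B \<ge> 0" unfolding B using w by (intro sum_nonneg) auto
  show "\<exists>F. has_circ n (5 * s + 4) F \<and> err n f w F \<le> 3 * e\<^sup>2 * mass n w"
  proof (cases "A = 0")
    \<comment> \<open>The reweighting of the other case would vanish identically here; F has no
      error under w already.\<close>
    case True
    have "0 \<le> 3 * e\<^sup>2 * mass n w" using mm[of w] w by simp
    then show ?thesis using F(1) True unfolding A_def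
      by (intro exI[of _ F]) (auto intro: has_circ_mono)
  next
    case False
    with A0 have A: "A > 0" by simp
    \<comment> \<open>The factors A on the correct and B on the wrong points give both groups the
      same mass A * B.\<close>
    define w2 where "w2 x = (if F x = f x then A else B) * w x" for x
    have "w2 x \<ge> 0" for x unfolding w2_def using w A0 B0 by simp
    with wl' obtain G where G: "has_circ n s G" "err n f w2 G \<le> e * mass n w2" by blast
    define u where "u = (\<Sum>x | length x = n. if F x \<noteq> f x \<and> G x \<noteq> f x then w x else 0)"
    define v where "v = (\<Sum>x | length x = n. if F x = f x \<and> G x \<noteq> f x then w x else 0)"
    have u0: "u \<ge> 0" unfolding u_def using w by (intro sum_nonneg) auto
    have e2: "err n f w2 G = B * u + A * v"
      unfolding err_eq u_def v_def sum_distrib_left sum.distrib[symmetric]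
      by (intro sum.cong) (auto simp: w2_def)
    have "mass n w2 = B * A + A * B"
      unfolding B unfolding mass_def A_def err_eq sum_distrib_left sum.distrib[symmetric]
      unfolding A_def[symmetric, unfolded err_eq] B[symmetric]
      by (intro sum.cong) (auto simp: w2_def)
    then have i2: "B * u + A * v \<le> e * (2 * A * B)"
      using G(2) e2 by (simp add: algebra_simps)
    define w3 where "w3 x = (if F x \<noteq> G x then w x else 0)" for x
    have "w3 x \<ge> 0" for x unfolding w3_def using w by simp
    with wl' obtain H where H: "has_circ n s H" "err n f w3 H \<le> e * mass n w3" by blast
    have m3: "mass n w3 = A - u + v"
      unfolding mass_def A_def err_eq u_def v_def sum_subtractf[symmetric] sum.distrib[symmetric]
      by (intro sum.cong) (auto simp: w3_def)
    let ?M = "\<lambda>x. F x \<and> G x \<or> H x \<and> (F x \<or> G x)"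
    \<comment> \<open>The majority fails where F and G both fail, and where they disagree and H
      fails.\<close>
    have "err n f w ?M = u + err n f w3 H"
      unfolding err_eq u_def sum.distrib[symmetric]
      by (intro sum.cong) (auto simp: w3_def)
    also have "\<dots> \<le> u + e * (A - u + v)" using H(2) m3 by simp
    also have "\<dots> \<le> 3 * e^2 * (A + B)"
      by (rule boost_ineq[OF A u0 assms(2) _ i2]) (use F(2) in \<open>simp add: A_def B_def\<close>)
    also have "A + B = mass n w" by (simp add: B_def)
    finally show ?thesis using has_circ_maj3[OF F(1) G(1) H(1)] by blast
  qed
qed

lemma weakly_learnable_mono:
  "weakly_learnable n f s e \<Longrightarrow> s \<le> s' \<Longrightarrow> weakly_learnable n f s' e"
  unfolding weakly_learnable_def using has_circ_mono by blast

text \<open>The recursions are explicit in shifted form: s + 1 is multiplied by 5, and 3 times the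
  error is squared, beginning with 3 * (1/6) = 1/2.\<close>

lemma boost_iterate:
  assumes "weakly_learnable n f s (1/6)"
  shows "weakly_learnable n f (5 ^ j * (s + 1)) ((1/3) * (1/2) ^ (2 ^ j))"
proof -
  have "weakly_learnable n f (5 ^ j * (s + 1) - 1) ((1/3) * (1/2) ^ (2 ^ j))"
  proof (induction j)
    case 0
    then show ?case using assms by simp
  next
    case (Suc j)
    have l: "(1/3) * (1/2::real) ^ (2 ^ j) < 1"
      using power_le_one[of "1/2::real" "2^j"] by simp
    have "weakly_learnable n f (5 * (5 ^ j * (s + 1) - 1) + 4) (3 * ((1/3) * (1/2) ^ (2 ^ j))^2)"
      by (rule boost_step[OF Suc.IH _ l]) simp
    moreover have "5 * (5 ^ j * (s + 1) - 1) + 4 = 5 ^ Suc j * (s + 1) - 1"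
    proof -
      have "1 * 1 \<le> 5 ^ j * (s + 1)" by (intro mult_le_mono) auto
      then show ?thesis by (simp add: algebra_simps)
    qed
    moreover have "3 * ((1/3) * (1/2::real) ^ (2 ^ j))^2 = (1/3) * (1/2) ^ (2 ^ Suc j)"
      by (simp add: power_mult_distrib power2_eq_square power_add[symmetric] mult_2)
    ultimately show ?case by (simp only:)
  qed
  then show ?thesis by (rule weakly_learnable_mono) simp
qed

text \<open>Under unit weights the error counts wrong points. Once \<open>2 ^ j\<close> reaches n it
  is at most 1/3, so no wrong point is left. Since also \<open>2 ^ j\<close> is at most 2 * n, the
  size factor satisfies 5^j \<le> 8^j = (2^j)^3 \<le> 8 * n^3.\<close>

lemma weakly_learnable_imp_circuit:
  assumes wl: "weakly_learnable n f s (1/6)" and n: "n \<ge> 1"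
  shows "has_circ n (8 * n ^ 3 * (s + 1)) f"
proof -
  obtain j where j: "n \<le> 2 ^ j" "2 ^ j \<le> 2 * n"
  proof -
    define j where "j = (LEAST j. n \<le> 2 ^ j)"
    have "n \<le> 2 ^ j" unfolding j_def by (rule LeastI[of _ n]) (simp add: less_imp_le)
    moreover have "2 ^ j \<le> 2 * n"
    proof (cases j)
      case (Suc i)
      then have "\<not> n \<le> 2 ^ i" unfolding j_def by (metis lessI not_less_Least)
      then show ?thesis using Suc by simp
    qed (use n in simp)
    ultimately show ?thesis using that by blast
  qed
  have "weakly_learnable n f (5 ^ j * (s + 1)) ((1/3) * (1/2) ^ (2 ^ j))"
    by (rule boost_iterate[OF wl])
  then obtain F where F: "has_circ n (5 ^ j * (s + 1)) F"
    "err n f (\<lambda>_. 1) F \<le> (1/3) * (1/2) ^ (2 ^ j) * mass n (\<lambda>_. 1)"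
    unfolding weakly_learnable_def by (metis zero_le_one)
  have "card {x :: bool list. length x = n} = 2 ^ n"
    using card_lists_length_eq[of "UNIV :: bool set" n] by simp
  then have m: "mass n (\<lambda>_. 1) = 2 ^ n" unfolding mass_def by simp
  have "(1/2::real) ^ (2 ^ j) \<le> (1/2) ^ n" using j(1) by (intro power_decreasing) auto
  then have "(1/3) * (1/2::real) ^ (2 ^ j) * 2 ^ n \<le> (1/3) * (1/2) ^ n * 2 ^ n"
    by (intro mult_right_mono) auto
  also have "\<dots> < 1" by (simp add: power_divide)
  finally have "err n f (\<lambda>_. 1) F < 1" using F(2) m by simp
  then have "card {x. length x = n \<and> F x \<noteq> f x} = 0" unfolding err_def by simp
  moreover have "finite {x. length x = n \<and> F x \<noteq> f x}"
    by (rule finite_subset[OF _ finite_cube[of n]]) auto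
  ultimately have eq: "F x = f x" if "length x = n" for x using that by auto
  have "(5::nat) ^ j \<le> (2 ^ 3) ^ j" by (intro power_mono) auto
  also have "\<dots> = (2 ^ j) ^ 3" by (simp only: power_mult[symmetric] mult.commute)
  also have "\<dots> \<le> (2 * n) ^ 3" using j(2) by (intro power_mono) auto
  finally have "5 ^ j * (s + 1) \<le> 8 * n ^ 3 * (s + 1)"
    by (intro mult_right_mono) (auto simp: power_mult_distrib)
  from has_circ_mono[OF F(1) this] show ?thesis
    by (rule has_circ_cong) (rule eq)
qed

section \<open>From weights to a hard distribution\<close>

lemma weight_pmf:
  assumes w: "\<And>x. w x \<ge> 0" and m: "mass n w > 0"
  obtains P :: "bool list pmf" where "set_pmf P \<subseteq> {x. length x = n}"
    "\<And>F. measure_pmf.prob P {x. F x = f x} = 1 - err n f w F / mass n w"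
proof -
  let ?X = "{x :: bool list. length x = n}"
  define p where "p x = (if length x = n then w x / mass n w else 0)" for x
  have p0: "p x \<ge> 0" for x unfolding p_def using w m by simp
  have "(\<integral>\<^sup>+ x. ennreal (p x) \<partial>count_space UNIV) = (\<Sum>x\<in>?X. ennreal (p x))"
    by (rule nn_integral_count_space'[OF finite_cube]) (auto simp: p_def)
  also have "\<dots> = ennreal (\<Sum>x\<in>?X. p x)" using p0 by (simp add: sum_ennreal)
  also have "(\<Sum>x\<in>?X. p x) = (\<Sum>x\<in>?X. w x / mass n w)" by (intro sum.cong) (auto simp: p_def)
  also have "\<dots> = 1" using m by (simp add: sum_divide_distrib[symmetric] mass_def)
  finally have i: "(\<integral>\<^sup>+ x. ennreal (p x) \<partial>count_space UNIV) = 1" by simp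
  define P where "P = embed_pmf p"
  have pmf: "pmf P x = p x" for x unfolding P_def by (rule pmf_embed_pmf[OF p0 i])
  have supp: "set_pmf P \<subseteq> ?X" by (auto simp: set_pmf_eq pmf p_def split: if_splits)
  have "measure_pmf.prob P {x. F x = f x} = 1 - err n f w F / mass n w" for F
  proof -
    have "measure_pmf.prob P {x. F x \<noteq> f x} = measure_pmf.prob P ({x. length x = n \<and> F x \<noteq> f x})"
      using supp by (intro measure_prob_cong_0) (auto simp: set_pmf_eq)
    also have "\<dots> = (\<Sum>x | length x = n \<and> F x \<noteq> f x. p x)"
      by (subst measure_measure_pmf_finite) (auto simp: pmf intro: finite_subset[OF _ finite_cube[of n]])
    also have "\<dots> = err n f w F / mass n w"
      unfolding err_def sum_divide_distrib by (intro sum.cong) (auto simp: p_def)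
    finally have "measure_pmf.prob P {x. F x \<noteq> f x} = err n f w F / mass n w" .
    moreover have "{x. F x \<noteq> f x} = UNIV - {x. F x = f x}" by auto
    ultimately show ?thesis using measure_pmf.prob_compl[of "{x. F x = f x}" P] by simp
  qed
  with supp show ?thesis by (rule that)
qed

lemma hard_distribution:
  assumes n: "n \<ge> 1" and s: "s \<ge> 1" and no: "\<not> has_circ n (8 * n ^ 3 * (s + 1)) f"
  obtains P :: "bool list pmf" where "set_pmf P \<subseteq> {x. length x = n}"
    "\<And>F. has_circ n s F \<Longrightarrow> measure_pmf.prob P {x. F x = f x} < 5/6"
proof -
  have "\<not> weakly_learnable n f s (1/6)" using weakly_learnable_imp_circuit n no by blast
  then obtain w where w: "\<And>x. w x \<ge> 0"
    and bad: "\<And>F. has_circ n s F \<Longrightarrow> err n f w F > 1/6 * mass n w"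
    unfolding weakly_learnable_def by (meson not_le)
  \<comment> \<open>Normalizing needs positive mass. Any circuit of size s shows it, as its error
    exceeds a sixth of the mass but not the mass; a single input vertex is such a circuit because s
    is at least 1.\<close>
  have "has_circ n s (\<lambda>x. x ! 0)"
    by (rule has_circ_mono[OF has_circ_Inp s]) (use n in simp)
  then have "1/6 * mass n w < err n f w (\<lambda>x. x ! 0)" by (rule bad)
  also have "\<dots> \<le> mass n w"
    unfolding err_def mass_def by (rule sum_mono2[OF finite_cube]) (auto simp: w)
  finally have m: "mass n w > 0" by simp
  obtain P where P: "set_pmf P \<subseteq> {x. length x = n}"
    "\<And>F. measure_pmf.prob P {x. F x = f x} = 1 - err n f w F / mass n w"
    using weight_pmf[OF w m] by blast
  have "measure_pmf.prob P {x. F x = f x} < 5/6" if "has_circ n s F" for F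
  proof -
    have "err n f w F / mass n w > 1/6" using bad[OF that] m by (simp add: field_simps)
    then show ?thesis using P(2) by simp
  qed
  with P(1) show ?thesis by (rule that)
qed

section \<open>Sample complexity of MDL\<close>

lemma mdl_candidates_nonempty:
  assumes "h \<in> consistent \<phi> n S"
  shows "mdl_candidates \<phi> n S \<noteq> {}"
  using ex_has_least_nat[of "\<lambda>h. h \<in> consistent \<phi> n S" h length] assms
  unfolding mdl_candidates_def by blast

text \<open>Consistency and minimal length are all that is used of the output, so every tie-breaking
  rule is covered.\<close>

lemma mdl_output:
  assumes "h \<in> consistent \<phi> n S" "valid_selector sel"
  obtains h' where "h' \<in> consistent \<phi> n S" "length h' \<le> length h"
    "mdl_acc \<phi> sel n f P S = measure_pmf.prob P {x. \<phi> h' x = Some (f x)}"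
proof -
  let ?C = "mdl_candidates \<phi> n S"
  have "?C \<noteq> {}" using mdl_candidates_nonempty[OF assms(1)] .
  moreover from this have "sel S ?C \<in> ?C" using assms(2) by (simp add: valid_selector_def)
  ultimately show ?thesis
    using assms(1) by (intro that[of "sel S ?C"]) (auto simp: mdl_candidates_def mdl_acc_def)
qed

lemma mdl_circuit_acc:
  assumes n: "n \<ge> 1" and sel: "valid_selector sel"
    and xs: "\<forall>x \<in> set xs. length x = n" and P: "set_pmf P \<subseteq> {x. length x = n}"
  obtains F where "has_circ n (4 + (3 * n + 1) * length xs) F"
    "mdl_acc circuit_interp sel n f P (map (\<lambda>x. (x, f x)) xs) = measure_pmf.prob P {x. F x = f x}"
proof -
  let ?S = "map (\<lambda>x. (x, f x)) xs"
  \<comment> \<open>Listing the positive sample points suffices: the table answers False elsewhere,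
    in particular on the negative ones.\<close>
  have "has_circ n (4 + (3 * n + 1) * length (filter f xs)) (\<lambda>x. x \<in> set (filter f xs))"
    by (rule has_circ_member[OF n]) (use xs in auto)
  then have "has_circ n (4 + (3 * n + 1) * length xs) (\<lambda>x. x \<in> set (filter f xs))"
    by (rule has_circ_mono) (intro add_left_mono mult_le_mono2 length_filter_le)
  then obtain vs where vs: "length vs \<le> 4 + (3 * n + 1) * length xs" "valid_circuit n vs"
    "\<And>x. length x = n \<Longrightarrow> circ_eval vs x = (x \<in> set (filter f xs))"
    unfolding has_circ_def circ_computes_def by blast
  have "circ_enc n vs \<in> consistent circuit_interp n ?S"
    unfolding consistent_def using xs vs by (auto simp: circuit_interp_enc)
  then obtain h where h: "h \<in> consistent circuit_interp n ?S" "length h \<le> length (circ_enc n vs)"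
    "mdl_acc circuit_interp sel n f P ?S = measure_pmf.prob P {x. circuit_interp h x = Some (f x)}"
    by (rule mdl_output[OF _ sel])
  \<comment> \<open>Consistency demands a value on the whole cube, even for an empty sample; hence
    any word of length n shows that h encodes a circuit on n inputs.\<close>
  have "circuit_interp h (replicate n False) \<noteq> None"
    using h(1) by (simp add: consistent_def)
  then obtain ws where ws: "valid_circuit n ws" "h = circ_enc n ws"
    by (elim circuit_interp_not_None) simp
  have "length ws \<le> length vs" using length_circ_enc_le_imp h(2) ws(2) by simp
  then have "has_circ n (4 + (3 * n + 1) * length xs) (circ_eval ws)"
    using ws(1) vs(1) unfolding has_circ_def circ_computes_def by (intro exI[of _ ws]) simp
  moreover have "measure_pmf.prob P {x. circuit_interp h x = Some (f x)} = measure_pmf.prob P {x. circ_eval ws x = f x}"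
    by (rule measure_prob_cong_0) (use P ws in \<open>auto simp: circuit_interp_enc set_pmf_eq\<close>)
  ultimately show ?thesis using h(3) that by simp
qed

section \<open>Lower bound for the circuit interpreter\<close>

lemma sample_cplx_ge:
  assumes "\<delta> < 1" "\<And>S. S \<in> set_pmf (dataset_pmf m f P) \<Longrightarrow> mdl_acc \<phi> sel n f P S < 1 - \<epsilon>"
  shows "sample_cplx \<phi> sel n \<epsilon> \<delta> f P \<ge> enat m"
proof -
  \<comment> \<open>\<open>pac_perf\<close> speaks of all sample sizes from k on, so certain failure
    at size m refutes it for each k up to m.\<close>
  have "m \<le> k" if "pac_perf \<phi> sel n \<epsilon> \<delta> k f P" for k
  proof (rule ccontr)
    assume "\<not> m \<le> k"
    then have "measure_pmf.prob (dataset_pmf m f P) {S. mdl_acc \<phi> sel n f P S \<ge> 1 - \<epsilon>} \<ge> 1 - \<delta>"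
      using that unfolding pac_perf_def by simp
    moreover have "measure_pmf.prob (dataset_pmf m f P) {S. mdl_acc \<phi> sel n f P S \<ge> 1 - \<epsilon>} = 0"
      using assms(2) by (force simp: measure_pmf_zero_iff)
    ultimately show False using assms(1) by simp
  qed
  then have "m \<le> (LEAST k. k \<ge> 1 \<and> pac_perf \<phi> sel n \<epsilon> \<delta> k f P)"
    if "\<exists>k \<ge> 1. pac_perf \<phi> sel n \<epsilon> \<delta> k f P"
    using LeastI_ex[OF that[unfolded Bex_def]] by blast
  then show ?thesis unfolding sample_cplx_def by simp
qed

text \<open>The excluded size is 8 * n^3 * (s + 1) for s = 4 + (3 * n + 1) * m, the size of a table
  for m samples. Boosting makes a distribution hard for all circuits of size s, and the output of
  MDL is one of these; the bound 5/6 on accuracy is 1 - \<epsilon>.\<close>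

lemma circuit_sample_cplx_ge:
  assumes n: "n \<ge> 1" and sel: "valid_selector sel"
    and no: "\<not> has_circ n (8 * n ^ 3 * (5 + (3 * n + 1) * m)) f"
  obtains P where "set_pmf P \<subseteq> {x. length x = n}"
    "sample_cplx circuit_interp sel n (1/6) (1/2) f P \<ge> enat m"
proof -
  let ?s = "4 + (3 * n + 1) * m"
  obtain P where P: "set_pmf P \<subseteq> {x. length x = n}"
    "\<And>F. has_circ n ?s F \<Longrightarrow> measure_pmf.prob P {x. F x = f x} < 5/6"
    by (rule hard_distribution[OF n, of ?s f]) (use no in simp_all)
  have "mdl_acc circuit_interp sel n f P S < 1 - 1/6" if "S \<in> set_pmf (dataset_pmf m f P)" for S
  proof -
    from that obtain xs where xs: "length xs = m" "set xs \<subseteq> set_pmf P" "S = map (\<lambda>x. (x, f x)) xs"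
      by (auto simp: dataset_pmf_def set_replicate_pmf in_lists_conv_set)
    have "\<forall>x\<in>set xs. length x = n" using xs(2) P(1) by blast
    then obtain F where "has_circ n (4 + (3 * n + 1) * length xs) F"
      "mdl_acc circuit_interp sel n f P (map (\<lambda>x. (x, f x)) xs) = measure_pmf.prob P {x. F x = f x}"
      using mdl_circuit_acc[OF n sel _ P(1)] by metis
    then show ?thesis using P(2)[of F] xs by simp
  qed
  then have "sample_cplx circuit_interp sel n (1/6) (1/2) f P \<ge> enat m"
    by (intro sample_cplx_ge) auto
  with P(1) show ?thesis by (rule that)
qed

section \<open>Upper bound for realizable targets\<close>

lemma prob_replicate_pmf_subset:
  fixes P :: "'a :: countable pmf"
  shows "measure_pmf.prob (replicate_pmf m P) {xs. set xs \<subseteq> A} = measure_pmf.prob P A ^ m"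
proof (induction m)
  case (Suc m)
  have "replicate_pmf (Suc m) P = map_pmf (\<lambda>(x, xs). x # xs) (pair_pmf P (replicate_pmf m P))"
    by (simp add: pair_pmf_def map_bind_pmf bind_assoc_pmf bind_return_pmf)
  moreover have "(\<lambda>(x, xs). x # xs) -` {xs. set xs \<subseteq> A} = A \<times> {xs. set xs \<subseteq> A}" by auto
  ultimately have "measure_pmf.prob (replicate_pmf (Suc m) P) {xs. set xs \<subseteq> A}
      = measure_pmf.prob (pair_pmf P (replicate_pmf m P)) (A \<times> {xs. set xs \<subseteq> A})"
    by (simp del: replicate_pmf.simps)
  then show ?case using Suc by (simp add: measure_pmf_prob_product del: replicate_pmf.simps)
qed simp

lemma mdl_realizable_pac:
  assumes sel: "valid_selector sel" and h: "\<And>x. length x = n \<Longrightarrow> \<phi> h x = Some (f x)"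
    and P: "set_pmf P \<subseteq> {x. length x = n}" and \<epsilon>: "0 < \<epsilon>" "\<epsilon> < 1"
    and m: "real (card {g :: bool list. length g \<le> length h}) * (1 - \<epsilon>) ^ m \<le> \<delta>"
  shows "pac_perf \<phi> sel n \<epsilon> \<delta> m f P"
  unfolding pac_perf_def
proof (intro allI impI)
  fix k assume k: "m \<le> k"
  let ?H = "{g :: bool list. length g \<le> length h}"
  let ?ok = "\<lambda>g. {x. \<phi> g x = Some (f x)}"
  let ?R = "replicate_pmf k P"
  let ?acc = "\<lambda>xs. mdl_acc \<phi> sel n f P (map (\<lambda>x. (x, f x)) xs)"
  \<comment> \<open>The bad programs are fixed before the sample is drawn, so independence applies
    to each of them: one survives k samples with probability at most (1 - \<epsilon>)^k.\<close>
  define Bad where "Bad = {g \<in> ?H. measure_pmf.prob P (?ok g) < 1 - \<epsilon>}"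
  have finH: "finite ?H" using finite_lists_length_le[of "UNIV :: bool set"] by simp
  have BadH: "Bad \<subseteq> ?H" unfolding Bad_def by blast
  then have finB: "finite Bad" using finH by (rule finite_subset)
  have sub: "{xs. ?acc xs < 1 - \<epsilon>} \<inter> set_pmf ?R \<subseteq> (\<Union>g\<in>Bad. {xs. set xs \<subseteq> ?ok g})"
  proof
    fix xs assume a: "xs \<in> {xs. ?acc xs < 1 - \<epsilon>} \<inter> set_pmf ?R"
    then have "set xs \<subseteq> set_pmf P" by (auto simp: set_replicate_pmf)
    then have "h \<in> consistent \<phi> n (map (\<lambda>x. (x, f x)) xs)"
      using P h by (auto simp: consistent_def)
    then obtain g where g: "g \<in> consistent \<phi> n (map (\<lambda>x. (x, f x)) xs)" "length g \<le> length h"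
      "?acc xs = measure_pmf.prob P (?ok g)"
      by (rule mdl_output[OF _ sel])
    then have "g \<in> Bad" using a by (simp add: Bad_def)
    moreover have "set xs \<subseteq> ?ok g" using g(1) by (auto simp: consistent_def)
    ultimately show "xs \<in> (\<Union>g\<in>Bad. {xs. set xs \<subseteq> ?ok g})" by blast
  qed
  \<comment> \<open>Off the support the sample may contain words of other lengths, on which h need
    not be correct; so the event is first cut down to the support.\<close>
  have "measure_pmf.prob ?R {xs. ?acc xs < 1 - \<epsilon>} = measure_pmf.prob ?R ({xs. ?acc xs < 1 - \<epsilon>} \<inter> set_pmf ?R)"
    by (simp add: measure_Int_set_pmf)
  also have "\<dots> \<le> measure_pmf.prob ?R (\<Union>g\<in>Bad. {xs. set xs \<subseteq> ?ok g})"
    by (rule measure_pmf.finite_measure_mono[OF sub]) simp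
  also have "\<dots> \<le> (\<Sum>g\<in>Bad. measure_pmf.prob ?R {xs. set xs \<subseteq> ?ok g})"
    by (rule measure_pmf.finite_measure_subadditive_finite[OF finB]) simp
  also have "\<dots> \<le> (\<Sum>g\<in>Bad. (1 - \<epsilon>) ^ m)"
  proof (rule sum_mono)
    fix g assume "g \<in> Bad"
    then have "measure_pmf.prob ?R {xs. set xs \<subseteq> ?ok g} \<le> (1 - \<epsilon>) ^ k"
      unfolding prob_replicate_pmf_subset Bad_def by (intro power_mono) auto
    also have "\<dots> \<le> (1 - \<epsilon>) ^ m" using k \<epsilon> by (intro power_decreasing) auto
    finally show "measure_pmf.prob ?R {xs. set xs \<subseteq> ?ok g} \<le> (1 - \<epsilon>) ^ m" .
  qed
  also have "\<dots> \<le> real (card ?H) * (1 - \<epsilon>) ^ m"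
    using \<epsilon> card_mono[OF finH BadH] by (simp add: mult_right_mono)
  also have "\<dots> \<le> \<delta>" by (rule m)
  finally have "measure_pmf.prob ?R {xs. ?acc xs < 1 - \<epsilon>} \<le> \<delta>" .
  moreover have "UNIV - {xs. ?acc xs < 1 - \<epsilon>} = {xs. 1 - \<epsilon> \<le> ?acc xs}" by auto
  ultimately have "measure_pmf.prob ?R {xs. 1 - \<epsilon> \<le> ?acc xs} \<ge> 1 - \<delta>"
    using measure_pmf.prob_compl[of "{xs. ?acc xs < 1 - \<epsilon>}" ?R] by simp
  then show "1 - \<delta> \<le> measure_pmf.prob (dataset_pmf k f P) {S. 1 - \<epsilon> \<le> mdl_acc \<phi> sel n f P S}"
    by (simp add: dataset_pmf_def)
qed

text \<open>The order of quantifiers matters: M depends only on l, \<epsilon> and \<delta>, because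
  the number of programs of length at most l involves neither n nor P. It is thus a constant in the
  denominator of the gain.\<close>

lemma mdl_realizable_sample_cplx:
  assumes \<epsilon>: "0 < \<epsilon>" "\<epsilon> < 1" and \<delta>: "0 < \<delta>"
  shows "\<exists>M \<ge> 1. \<forall>\<phi> sel n f P h. valid_selector sel \<longrightarrow> length h = l \<longrightarrow>
    (\<forall>x. length x = n \<longrightarrow> \<phi> h x = Some (f x)) \<longrightarrow> set_pmf P \<subseteq> {x. length x = n} \<longrightarrow>
    (\<exists>k. 1 \<le> k \<and> k \<le> M \<and> sample_cplx \<phi> sel n \<epsilon> \<delta> f P = enat k)"
proof -
  let ?N = "real (card {g :: bool list. length g \<le> l})"
  have "(\<lambda>m. (1 - \<epsilon>) ^ m) \<longlonglongrightarrow> 0" using \<epsilon> by (intro LIMSEQ_power_zero) auto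
  then have "(\<lambda>m. ?N * (1 - \<epsilon>) ^ m) \<longlonglongrightarrow> ?N * 0" by (rule tendsto_mult_left)
  then have "\<forall>\<^sub>F m in sequentially. ?N * (1 - \<epsilon>) ^ m < \<delta>" using \<delta> by (intro order_tendstoD(2)) auto
  then obtain M0 where M0: "\<And>m. m \<ge> M0 \<Longrightarrow> ?N * (1 - \<epsilon>) ^ m < \<delta>"
    unfolding eventually_sequentially by blast
  define M where "M = max M0 1"
  have M: "?N * (1 - \<epsilon>) ^ M \<le> \<delta>" using M0[of M] by (simp add: M_def)
  show ?thesis
  proof (rule exI[of _ M], intro conjI allI impI)
    show M1: "M \<ge> 1" by (simp add: M_def)
    fix \<phi> :: interp and sel n f and P :: "bool list pmf" and h :: "bool list"
    assume sel: "valid_selector sel" and l: "length h = l"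
      and h: "\<forall>x. length x = n \<longrightarrow> \<phi> h x = Some (f x)" and P: "set_pmf P \<subseteq> {x. length x = n}"
    let ?k = "LEAST m. m \<ge> 1 \<and> pac_perf \<phi> sel n \<epsilon> \<delta> m f P"
    have p: "M \<ge> 1 \<and> pac_perf \<phi> sel n \<epsilon> \<delta> M f P"
      using mdl_realizable_pac[where \<phi> = \<phi> and h = h, OF sel h[rule_format] P \<epsilon>] M M1 l by simp
    have "?k \<le> M" by (rule Least_le[of "\<lambda>m. m \<ge> 1 \<and> pac_perf \<phi> sel n \<epsilon> \<delta> m f P", OF p])
    moreover have "?k \<ge> 1" using LeastI[of "\<lambda>m. m \<ge> 1 \<and> pac_perf \<phi> sel n \<epsilon> \<delta> m f P", OF p] by blast
    moreover have "sample_cplx \<phi> sel n \<epsilon> \<delta> f P = enat ?k" unfolding sample_cplx_def using p by auto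
    ultimately show "\<exists>k. 1 \<le> k \<and> k \<le> M \<and> sample_cplx \<phi> sel n \<epsilon> \<delta> f P = enat k" by blast
  qed
qed

section \<open>A padding Turing machine\<close>

lemma run_halted: "halted M c \<Longrightarrow> run M xs t c = Some c"
  by (cases t) auto

lemma run_add: "run M xs (s + t) c = Option.bind (run M xs s c) (run M xs t)"
proof (induction s arbitrary: c)
  case (Suc s)
  show ?case
  proof (cases "halted M c")
    case True
    then show ?thesis by (simp add: run_halted)
  next
    case False
    then show ?thesis using Suc by (cases "step M xs c") auto
  qed
qed simp

lemma run_trans: "run M xs s c = Some c1 \<Longrightarrow> run M xs t c1 = Some c2 \<Longrightarrow> run M xs (s + t) c = Some c2"
  by (simp add: run_add)

lemma run_step: "\<not> halted M c \<Longrightarrow> step M xs c = Some c1 \<Longrightarrow> run M xs 1 c = Some c1"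
  by simp

lemma run_Suc: "\<not> halted M c \<Longrightarrow> step M xs c = Some c1 \<Longrightarrow> run M xs t c1 = Some c2 \<Longrightarrow> run M xs (Suc t) c = Some c2"
  by simp

lemma find_append: "find P (xs @ ys) = (case find P xs of None \<Rightarrow> find P ys | Some x \<Rightarrow> Some x)"
  by (induction xs) auto

lemma find_SomeD: "find P xs = Some x \<Longrightarrow> x \<in> set xs \<and> P x"
  by (auto simp: find_Some_iff)

lemma find_unique:
  assumes "x \<in> set xs" "P x" "\<And>y. y \<in> set xs \<Longrightarrow> P y \<Longrightarrow> y = x"
  shows "find P xs = Some x"
proof (cases "find P xs")
  case None
  then show ?thesis using assms(1,2) by (auto simp: find_None_iff)
next
  case (Some y)
  then show ?thesis using assms(3) find_SomeD[of P xs y] by blast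
qed

lemma find_concat_map:
  assumes "\<And>x. x \<in> set xs \<Longrightarrow> find P (g x) = (if Q x then Some (h x) else None)"
  shows "find P (concat (map g xs)) = map_option h (find Q xs)"
  using assms by (induction xs) (auto simp: find_append)

lemma map_upt_add: "map f [0..<m + k] = map f [0..<m] @ map (\<lambda>j. f (m + j)) [0..<k]" for m k :: nat
  by (induction k) simp_all

lemma map_upt_Suc0: "map f [0..<Suc k] = f 0 # map (\<lambda>j. f (Suc j)) [0..<k]"
  by (induction k) auto

section \<open>The rule table of the padded machine\<close>

abbreviation syms :: "sym list" where
  "syms \<equiv> [Zero, One, Blank]"

lemma set_syms: "set syms = UNIV"
proof -
  have "y \<in> set syms" for y by (cases y) auto
  then show ?thesis by blast
qed

lemma set_words: "set (List.n_lists k syms) = {ys. length ys = k}"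
  unfolding set_n_lists set_syms by simp

text \<open>The padded machine has work tapes A, B, W besides those of M. A and B carry a mark in
  cell 0 only and serve as counters through their head positions. In each round (state 1) the
  position of A is doubled, in states 2 to 4, by moving it to B and back at double speed, while
  the input head advances by the old position; each round also writes \<open>a\<close> ones on W
  (states \<open>9, \<dots>, 8 + a\<close>). Once the input head has left the input, the heads are rewound
  (states 5, 6), the ones on W are overwritten by input symbols (state 7), A and W are rewound
  (state 8), and M is run with W as its input tape.\<close>
definition prep :: "nat \<Rightarrow> nat \<Rightarrow> nat \<Rightarrow> sym \<Rightarrow> sym \<Rightarrow> sym \<Rightarrow> sym \<Rightarrow> nat \<times> sym \<times> mv \<times> mv \<times> mv \<times> mv" where
  "prep a s q i x y z =
     (if q = 0 then (1, z, MvS, MvR, MvS, MvS)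
      else if q = 1 then (if i = Blank then 5 else 9, z, MvS, MvS, MvS, MvS)
      else if q = 2 then (if x = One then (3, z, MvS, MvS, MvS, MvS) else (2, z, MvR, MvL, MvR, MvS))
      else if q = 3 then (if y = One then (1, z, MvS, MvS, MvS, MvS) else (4, z, MvS, MvR, MvL, MvS))
      else if q = 4 then (3, z, MvS, MvR, MvS, MvS)
      else if q = 5 then (if x = One then (6, z, MvR, MvS, MvS, MvL) else (5, z, MvL, MvL, MvS, MvS))
      else if q = 6 then (if z = Blank then (7, z, MvS, MvS, MvS, MvR) else (6, z, MvS, MvS, MvS, MvL))
      else if q = 7 then (if z = Blank then (8, z, MvS, MvS, MvS, MvS) else (7, i, MvR, MvR, MvS, MvR))
      else if q = 8 then (if x = One then (s, z, MvS, MvS, MvS, MvS) else (8, z, MvS, MvL, MvS, MvL))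
      else (if q + 1 < 9 + a then q + 1 else 2, One, MvS, MvS, MvS, MvR))"

type_synonym tm_rule = "nat \<times> sym list \<times> nat \<times> sym list \<times> mv list"

text \<open>The symbols read are those on the input, on A, B and W, then on the tapes of M. Only
  state 0 writes on A and B, which sets the two marks.\<close>

fun prep_rule :: "nat \<Rightarrow> nat \<Rightarrow> nat \<Rightarrow> sym list \<Rightarrow> tm_rule" where
  "prep_rule a s q (i # x # y # z # r) =
     (case prep a s q i x y z of (q', w, mi, mA, mB, mW) \<Rightarrow>
       (q, i # x # y # z # r, q', [if q = 0 then One else x, if q = 0 then One else y, w] @ r,
        [mi, mA, mB, mW] @ replicate (length r) MvS))"
| "prep_rule a s q _ = (q, [], 0, [], [])"

definition prep_rules :: "nat \<Rightarrow> nat \<Rightarrow> nat \<Rightarrow> tm_rule list" where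
  "prep_rules a s k = concat (map (\<lambda>q. map (prep_rule a s q) (List.n_lists (4 + k) syms)) [0..<9 + a])"

lemma mem_prep_rules:
  "p \<in> set (prep_rules a s k) \<longleftrightarrow> (\<exists>q < 9 + a. \<exists>r. length r = 4 + k \<and> p = prep_rule a s q r)"
proof -
  have W: "p \<in> set (concat (map (\<lambda>q. map (prep_rule a s q) W) [0..<9 + a])) \<longleftrightarrow>
      (\<exists>q < 9 + a. \<exists>r \<in> set W. p = prep_rule a s q r)" for W
    by auto
  show ?thesis unfolding prep_rules_def W by (auto simp: set_words)
qed

text \<open>As W is the last of the added tapes, \<open>u @ r\<close> puts the input symbol of M in
  the place of W. The read-only input becomes a work tape whose symbol \<open>hd r\<close> is always
  written back.\<close>

fun lift_rule :: "nat \<Rightarrow> tm_rule \<Rightarrow> sym list \<Rightarrow> tm_rule" where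
  "lift_rule e (q, r, q', w, m) u = (e + q, u @ r, e + q', [u ! 1, u ! 2, hd r] @ w, [MvS, MvS, MvS] @ m)"

definition pad_tm :: "nat \<Rightarrow> tm \<Rightarrow> tm" where
  "pad_tm a M = \<lparr>nin = 1, nwork = 3 + nwork M, q0 = 0, qacc = 9 + a + qacc M, qrej = 9 + a + qrej M,
     rules = prep_rules a (9 + a + q0 M) (nwork M) @
       concat (map (\<lambda>p. map (lift_rule (9 + a) p) (List.n_lists 3 syms)) (rules M))\<rparr>"

lemma pad_tm_simps [simp]:
  "nin (pad_tm a M) = 1" "nwork (pad_tm a M) = 3 + nwork M" "q0 (pad_tm a M) = 0"
  "qacc (pad_tm a M) = 9 + a + qacc M" "qrej (pad_tm a M) = 9 + a + qrej M"
  by (simp_all add: pad_tm_def)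

lemma list_length_4: "length r = 4 + k \<Longrightarrow> \<exists>i x y z u. r = i # x # y # z # u \<and> length u = k"
  by (simp add: numeral_eq_Suc length_Suc_conv) blast

lemma list_length_3: "length r = 3 \<Longrightarrow> \<exists>i x y. r = [i, x, y]"
  by (simp add: numeral_eq_Suc length_Suc_conv) blast

lemma wf_pad_tm:
  assumes "wf_tm M" "nin M = 1"
  shows "wf_tm (pad_tm a M)"
proof -
  let ?ok = "\<lambda>(q, r, q', w, m). length r = 4 + nwork M \<and> length w = 3 + nwork M \<and> length m = 4 + nwork M"
  have "?ok p" if p: "p \<in> set (rules (pad_tm a M))" for p
  proof -
    from p consider q r where "r \<in> set (List.n_lists (4 + nwork M) syms)" "p = prep_rule a (9 + a + q0 M) q r"
      | u p' where "u \<in> set (List.n_lists 3 syms)" "p' \<in> set (rules M)" "p = lift_rule (9 + a) p' u"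
      unfolding pad_tm_def prep_rules_def by auto
    then show ?thesis
    proof cases
      case 1
      then obtain i x y z u where "r = i # x # y # z # u" "length u = nwork M"
        unfolding set_words using list_length_4 by blast
      then show ?thesis using 1(2) by (auto split: prod.split)
    next
      case 2
      then have "length u = 3" unfolding set_words by simp
      obtain q r q' w m where p': "p' = (q, r, q', w, m)" by (cases p')
      then have "length r = 1 + nwork M \<and> length w = nwork M \<and> length m = 1 + nwork M"
        using assms 2(2) unfolding wf_tm_def by fastforce
      then show ?thesis using 2(3) p' \<open>length u = 3\<close> by simp
    qed
  qed
  then have ok: "?ok p" if "p \<in> set (rules (pad_tm a M))" for p using that by blast
  show ?thesis
    unfolding wf_tm_def
  proof (intro conjI ballI)
    show "qacc (pad_tm a M) \<noteq> qrej (pad_tm a M)" using assms(1) by (simp add: wf_tm_def)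
    fix p assume "p \<in> set (rules (pad_tm a M))"
    from ok[OF this] show "case p of (q, r, q', w, m) \<Rightarrow>
        length r = nin (pad_tm a M) + nwork (pad_tm a M) \<and>
        length w = nwork (pad_tm a M) \<and> length m = nin (pad_tm a M) + nwork (pad_tm a M)"
      by (cases p) simp
  qed
qed

lemma find_prep_rule:
  assumes "q < 9 + a" "length r = nwork M"
  shows "find (\<lambda>(p, s, _, _, _). p = q \<and> s = i # x # y # z # r) (rules (pad_tm a M))
    = Some (prep_rule a (9 + a + q0 M) q (i # x # y # z # r))"
proof -
  let ?P = "\<lambda>(p, s, _ :: nat, _ :: sym list, _ :: mv list). p = q \<and> s = i # x # y # z # r"
  have "find ?P (prep_rules a (9 + a + q0 M) (nwork M)) = Some (prep_rule a (9 + a + q0 M) q (i # x # y # z # r))"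
  proof (rule find_unique)
    show "prep_rule a (9 + a + q0 M) q (i # x # y # z # r) \<in> set (prep_rules a (9 + a + q0 M) (nwork M))"
      unfolding mem_prep_rules using assms by (intro exI[of _ q] conjI exI[of _ "i # x # y # z # r"]) simp_all
    show "?P (prep_rule a (9 + a + q0 M) q (i # x # y # z # r))" by (simp split: prod.split)
  next
    fix p assume "p \<in> set (prep_rules a (9 + a + q0 M) (nwork M))" and P: "?P p"
    then obtain q1 r1 where p: "p = prep_rule a (9 + a + q0 M) q1 r1" "length r1 = 4 + nwork M"
      unfolding mem_prep_rules by blast
    then obtain i1 x1 y1 z1 u1 where "r1 = i1 # x1 # y1 # z1 # u1" using list_length_4 by blast
    then show "p = prep_rule a (9 + a + q0 M) q (i # x # y # z # r)"
      using P p(1) by (auto split: prod.splits)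
  qed
  then show ?thesis by (simp add: pad_tm_def find_append)
qed

text \<open>Preparation rules have states below \<open>9 + a\<close> and cannot match. Each rule of
  M expands to a block with at most one match, so the priority among the rules of M is
  preserved.\<close>

lemma find_lift_rule:
  assumes "wf_tm M" "nin M = 1"
    and "find (\<lambda>(p, s, _, _, _). p = q \<and> s = r) (rules M) = Some p"
  shows "find (\<lambda>(p, s, _, _, _). p = 9 + a + q \<and> s = i # x # y # r) (rules (pad_tm a M))
    = Some (lift_rule (9 + a) p [i, x, y])"
proof -
  let ?Q = "\<lambda>(p, s, _ :: nat, _ :: sym list, _ :: mv list). p = q \<and> s = r"
  let ?P = "\<lambda>(p, s, _ :: nat, _ :: sym list, _ :: mv list). p = 9 + a + q \<and> s = i # x # y # r"
  have "find ?P (prep_rules a (9 + a + q0 M) (nwork M)) = None"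
  proof -
    have "\<not> ?P p" if pp: "p \<in> set (prep_rules a (9 + a + q0 M) (nwork M))" for p
    proof -
      obtain q1 r1 where p: "p = prep_rule a (9 + a + q0 M) q1 r1" "length r1 = 4 + nwork M" "q1 < 9 + a"
        using pp unfolding mem_prep_rules by blast
      then obtain i1 x1 y1 z1 u1 where "r1 = i1 # x1 # y1 # z1 # u1" using list_length_4 by blast
      then show ?thesis using p by (auto split: prod.splits)
    qed
    then show ?thesis unfolding find_None_iff by blast
  qed
  moreover have "find ?P (concat (map (\<lambda>p. map (lift_rule (9 + a) p) (List.n_lists 3 syms)) (rules M)))
      = map_option (\<lambda>p. lift_rule (9 + a) p [i, x, y]) (find ?Q (rules M))"
  proof (rule find_concat_map)
    fix p assume "p \<in> set (rules M)"
    obtain q1 r1 q1' w1 m1 where p: "p = (q1, r1, q1', w1, m1)" by (cases p)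
    let ?L = "map (lift_rule (9 + a) p) (List.n_lists 3 syms)"
    show "find ?P ?L = (if ?Q p then Some (lift_rule (9 + a) p [i, x, y]) else None)"
    proof (cases "?Q p")
      case True
      have "find ?P ?L = Some (lift_rule (9 + a) p [i, x, y])"
      proof (rule find_unique)
        show "lift_rule (9 + a) p [i, x, y] \<in> set ?L" unfolding set_map set_words by simp
        show "?P (lift_rule (9 + a) p [i, x, y])" using True p by simp
        fix p' assume "p' \<in> set ?L" and P: "?P p'"
        then obtain u where u: "length u = 3" "p' = lift_rule (9 + a) p u"
          unfolding set_map set_words by auto
        then obtain i1 x1 y1 where "u = [i1, x1, y1]" using list_length_3 by blast
        then show "p' = lift_rule (9 + a) p [i, x, y]" using P u p by auto
      qed
      then show ?thesis using True by simp
    next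
      case False
      have "\<not> ?P p'" if p': "p' \<in> set ?L" for p'
      proof -
        from p' obtain u where u: "length u = 3" "p' = lift_rule (9 + a) p u"
          unfolding set_map set_words by auto
        then obtain i1 x1 y1 where "u = [i1, x1, y1]" using list_length_3 by blast
        then show ?thesis using False u p by auto
      qed
      then have "find ?P ?L = None" unfolding find_None_iff by blast
      then show ?thesis using False by simp
    qed
  qed
  ultimately show ?thesis using assms(3) by (simp add: pad_tm_def find_append)
qed

lemma reads_pad_tm:
  assumes "length hs = nwork M" "length ws = nwork M"
  shows "reads (pad_tm a M) [x] (q, [hi, hA, hB, hW] @ hs, [tA, tB, tW] @ ws)
    = inp_sym x hi # tA hA # tB hB # tW hW # map (\<lambda>j. (ws ! j) (hs ! j)) [0..<nwork M]"
  unfolding reads_def prod.case pad_tm_simps map_upt_add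
  by (simp add: upt_rec numeral_eq_Suc)

lemma map_moved_heads:
  "map (\<lambda>j. mvh (([hi, hA, hB, hW] @ hs) ! j) (([mi, mA, mB, mW] @ m) ! j)) [0..<1 + (3 + k)]
    = [mvh hi mi, mvh hA mA, mvh hB mB, mvh hW mW] @ map (\<lambda>j. mvh (hs ! j) (m ! j)) [0..<k]"
  unfolding map_upt_add by (simp add: upt_rec numeral_eq_Suc)

lemma map_written_tapes:
  "map (\<lambda>j. (([tA, tB, tW] @ ws) ! j)((([hi, hA, hB, hW] @ hs) ! (1 + j)) := ([wA, wB, wW] @ w) ! j)) [0..<3 + k]
    = [tA(hA := wA), tB(hB := wB), tW(hW := wW)] @ map (\<lambda>j. (ws ! j)(hs ! j := w ! j)) [0..<k]"
  unfolding map_upt_add by (simp add: upt_rec numeral_eq_Suc)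

lemma step_prep:
  assumes k: "length hs = nwork M" "length ws = nwork M" and q: "q < 9 + a"
    and p: "prep a (9 + a + q0 M) q (inp_sym x hi) (tA hA) (tB hB) (tW hW) = (q', wW, mi, mA, mB, mW)"
  shows "step (pad_tm a M) [x] (q, [hi, hA, hB, hW] @ hs, [tA, tB, tW] @ ws) =
    Some (q', [mvh hi mi, mvh hA mA, mvh hB mB, mvh hW mW] @ hs,
      [if q = 0 then tA(hA := One) else tA, if q = 0 then tB(hB := One) else tB, tW(hW := wW)] @ ws)"
proof -
  let ?r = "map (\<lambda>j. (ws ! j) (hs ! j)) [0..<nwork M]"
  have hs: "map (\<lambda>j. mvh (hs ! j) (replicate (nwork M) MvS ! j)) [0..<nwork M] = hs"
    using k by (intro nth_equalityI) (auto simp: mvh_def)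
  have ws: "map (\<lambda>j. (ws ! j)(hs ! j := ?r ! j)) [0..<nwork M] = ws"
    using k by (intro nth_equalityI) auto
  have f: "find (\<lambda>(p, r, _, _, _). p = q \<and> r = reads (pad_tm a M) [x] (q, [hi, hA, hB, hW] @ hs, [tA, tB, tW] @ ws))
      (rules (pad_tm a M)) = Some (prep_rule a (9 + a + q0 M) q
        (inp_sym x hi # tA hA # tB hB # tW hW # ?r))"
    unfolding reads_pad_tm[OF k] by (rule find_prep_rule[OF q]) simp
  show ?thesis
    unfolding step_def prod.case f prep_rule.simps p option.case pad_tm_simps map_moved_heads map_written_tapes
      length_map length_upt diff_zero hs ws by simp
qed

text \<open>The tape W with content \<open>inp_sym y\<close> behaves exactly like an input tape
  holding y: both extend in both directions, are blank outside y and are never changed.\<close>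

lemma step_lift:
  assumes M: "wf_tm M" "nin M = 1" and k: "length hs = nwork M" "length ws = nwork M"
    and st: "step M [y] (q, h # hs, ws) = Some (q', hs', ws')"
  shows "step (pad_tm a M) [x] (9 + a + q, [hi, hA, hB, h] @ hs, [tA, tB, inp_sym y] @ ws) =
    Some (9 + a + q', [hi, hA, hB] @ hs', [tA, tB, inp_sym y] @ ws')"
    and "length hs' = 1 + nwork M" "length ws' = nwork M"
proof -
  let ?r = "map (\<lambda>j. (ws ! j) (hs ! j)) [0..<nwork M]"
  have rd: "reads M [y] (q, h # hs, ws) = inp_sym y h # ?r"
    unfolding reads_def prod.case M(2) by simp
  obtain p where p: "find (\<lambda>(p, r, _, _, _). p = q \<and> r = inp_sym y h # ?r) (rules M) = Some p"
    using st unfolding step_def rd by (auto split: option.splits)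
  obtain q1 r1 q1' w m where pe: "p = (q1, r1, q1', w, m)" by (cases p)
  have pm: "p \<in> set (rules M)" and r1: "r1 = inp_sym y h # ?r" "q1 = q"
    using find_SomeD[OF p] pe by auto
  have "length m = 1 + nwork M" using pm M pe unfolding wf_tm_def by auto
  then obtain m0 ms where m: "m = m0 # ms" by (cases m) auto
  have s: "q' = q1'" "hs' = mvh h m0 # map (\<lambda>j. mvh (hs ! j) (ms ! j)) [0..<nwork M]"
    "ws' = map (\<lambda>j. (ws ! j)(hs ! j := w ! j)) [0..<nwork M]"
    using st unfolding step_def rd p[unfolded pe] prod.case option.case M(2) m
    by (auto simp: map_upt_Suc0 simp del: upt_Suc)
  show "length hs' = 1 + nwork M" "length ws' = nwork M" using s by auto
  have f: "find (\<lambda>(p, r, _, _, _). p = 9 + a + q \<and>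
        r = reads (pad_tm a M) [x] (9 + a + q, [hi, hA, hB, h] @ hs, [tA, tB, inp_sym y] @ ws))
      (rules (pad_tm a M)) = Some (lift_rule (9 + a) p [inp_sym x hi, tA hA, tB hB])"
    unfolding reads_pad_tm[OF k] by (rule find_lift_rule[OF M p])
  have l: "lift_rule (9 + a) p [inp_sym x hi, tA hA, tB hB] =
      (9 + a + q, [inp_sym x hi, tA hA, tB hB] @ inp_sym y h # ?r, 9 + a + q1', [tA hA, tB hB, inp_sym y h] @ w,
       [MvS, MvS, MvS, m0] @ ms)"
    by (simp add: pe r1 m)
  show "step (pad_tm a M) [x] (9 + a + q, [hi, hA, hB, h] @ hs, [tA, tB, inp_sym y] @ ws) =
    Some (9 + a + q', [hi, hA, hB] @ hs', [tA, tB, inp_sym y] @ ws')"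
    unfolding step_def prod.case f l option.case pad_tm_simps map_moved_heads map_written_tapes
    by (simp add: s mvh_def)
qed

lemma halted_pad_tm: "halted (pad_tm a M) (9 + a + q, c) \<longleftrightarrow> halted M (q, c')"
  by (auto simp: halted_def)

text \<open>Lifting costs no time. Only the final state is tracked, since it alone determines the
  output.\<close>

lemma run_lift:
  assumes M: "wf_tm M" "nin M = 1"
    and "length hs = nwork M" "length ws = nwork M" "run M [y] t (q, h # hs, ws) = Some (q', hs', ws')"
  shows "\<exists>c. run (pad_tm a M) [x] t (9 + a + q, [hi, hA, hB, h] @ hs, [tA, tB, inp_sym y] @ ws) = Some (9 + a + q', c)"
  using assms(3-)
proof (induction t arbitrary: q h hs ws)
  case (Suc t)
  show ?case
  proof (cases "halted M (q, h # hs, ws)")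
    case True
    then show ?thesis using Suc.prems halted_pad_tm by (auto simp: halted_pad_tm[where c' = "(h # hs, ws)"])
  next
    case False
    then obtain c1 where c1: "step M [y] (q, h # hs, ws) = Some c1" "run M [y] t c1 = Some (q', hs', ws')"
      using Suc.prems(3) by (cases "step M [y] (q, h # hs, ws)") auto
    obtain q1 hs1 ws1 where e: "c1 = (q1, hs1, ws1)" by (cases c1)
    note st = step_lift[OF M Suc.prems(1,2) c1(1)[unfolded e]]
    obtain h1 hs2 where hs1: "hs1 = h1 # hs2" using st(2) by (cases hs1) auto
    have "\<exists>c. run (pad_tm a M) [x] t (9 + a + q1, [hi, hA, hB, h1] @ hs2, [tA, tB, inp_sym y] @ ws1) = Some (9 + a + q', c)"
      by (rule Suc.IH) (use st(2,3) c1(2) e hs1 in auto)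
    then show ?thesis
      using st(1)[of a x hi hA hB tA tB] False hs1 by (simp add: halted_pad_tm[where c' = "(h # hs, ws)"])
  qed
qed simp

section \<open>Runs of the preparation phase\<close>

definition mark :: "int \<Rightarrow> sym" where
  "mark = (\<lambda>_. Blank)(0 := One)"

lemma mark_0 [simp]: "mark 0 = One"
  and mark_nonzero [simp]: "i \<noteq> 0 \<Longrightarrow> mark i = Blank"
  by (auto simp: mark_def)

definition cfg :: "tm \<Rightarrow> nat \<Rightarrow> int \<Rightarrow> int \<Rightarrow> int \<Rightarrow> int \<Rightarrow> (int \<Rightarrow> sym) \<Rightarrow> config" where
  "cfg M q hi hA hB hW tW = (q, [hi, hA, hB, hW] @ replicate (nwork M) 0,
     [mark, mark, tW] @ replicate (nwork M) (\<lambda>_. Blank))"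

lemma run_cfg_Suc:
  assumes "1 \<le> q" "q < 9 + a"
    and "prep a (9 + a + q0 M) q (inp_sym x hi) (mark hA) (mark hB) (tW hW) = (q', wW, mi, mA, mB, mW)"
    and "run (pad_tm a M) [x] t (cfg M q' (mvh hi mi) (mvh hA mA) (mvh hB mB) (mvh hW mW) (tW(hW := wW))) = Some c"
  shows "run (pad_tm a M) [x] (Suc t) (cfg M q hi hA hB hW tW) = Some c"
proof (rule run_Suc)
  show "\<not> halted (pad_tm a M) (cfg M q hi hA hB hW tW)"
    using assms(2) by (simp add: cfg_def halted_def)
  show "step (pad_tm a M) [x] (cfg M q hi hA hB hW tW) =
      Some (cfg M q' (mvh hi mi) (mvh hA mA) (mvh hB mB) (mvh hW mW) (tW(hW := wW)))"
    using step_prep[where hs = "replicate (nwork M) 0" and ws = "replicate (nwork M) (\<lambda>_. Blank)"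
        and tA = mark and tB = mark and tW = tW and hW = hW, OF _ _ assms(2,3)] assms(1) by (simp add: cfg_def)
qed (rule assms(4))

abbreviation reach :: "nat \<Rightarrow> tm \<Rightarrow> bool list \<Rightarrow> nat \<Rightarrow> config \<Rightarrow> config \<Rightarrow> bool" where
  "reach a M x t c c' \<equiv> run (pad_tm a M) [x] t c = Some c'"

lemma run_start: "reach a M x 1 (init_config (pad_tm a M)) (cfg M 1 0 1 0 0 (\<lambda>_. Blank))"
proof (rule run_step)
  show "\<not> halted (pad_tm a M) (init_config (pad_tm a M))"
    by (simp add: halted_def init_config_def)
  have i: "init_config (pad_tm a M) = (0, [0, 0, 0, 0] @ replicate (nwork M) 0,
      [\<lambda>_. Blank, \<lambda>_. Blank, \<lambda>_. Blank] @ replicate (nwork M) (\<lambda>_. Blank))"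
    by (simp add: init_config_def numeral_eq_Suc)
  show "step (pad_tm a M) [x] (init_config (pad_tm a M)) = Some (cfg M 1 0 1 0 0 (\<lambda>_. Blank))"
    unfolding i cfg_def mark_def
    by (subst step_prep) (auto simp: prep_def mvh_def)
qed

definition ones :: "nat \<Rightarrow> int \<Rightarrow> sym" where
  "ones m i = (if 0 \<le> i \<and> i < int m then One else Blank)"

lemma ones_0: "ones 0 = (\<lambda>_. Blank)"
  by (auto simp: ones_def)

lemma ones_Suc: "(ones m)(int m := One) = ones (Suc m)"
  by (auto simp: ones_def)

lemma ones_Blank: "ones m i = Blank \<longleftrightarrow> i < 0 \<or> int m \<le> i"
  by (auto simp: ones_def)

lemma ones_upd_Blank: "i < 0 \<Longrightarrow> (ones m)(i := Blank) = ones m"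
  by (auto simp: ones_def fun_eq_iff)

text \<open>Here i is the number of ones still to be written in the current round.\<close>

lemma run_write_ones:
  assumes "i \<ge> 1" "i \<le> a"
  shows "reach a M x i (cfg M (9 + (a - i)) hi hA hB (int m) (ones m)) (cfg M 2 hi hA hB (int (m + i)) (ones (m + i)))"
  using assms
proof (induction i arbitrary: m rule: nat_induct_at_least)
  case base
  then have "reach a M x (Suc 0) (cfg M (9 + (a - 1)) hi hA hB (int m) (ones m)) (cfg M 2 hi hA hB (int (m + 1)) (ones (m + 1)))"
    by (intro run_cfg_Suc) (auto simp: prep_def mvh_def ones_Suc add_ac)
  then show ?case by simp
next
  case (Suc i)
  have "reach a M x (Suc i) (cfg M (9 + (a - Suc i)) hi hA hB (int m) (ones m)) (cfg M 2 hi hA hB (int (Suc m + i)) (ones (Suc m + i)))"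
  proof (rule run_cfg_Suc)
    show "prep a (9 + a + q0 M) (9 + (a - Suc i)) (inp_sym x hi) (mark hA) (mark hB) (ones m (int m)) =
       (9 + (a - i), One, MvS, MvS, MvS, MvR)"
    proof -
      obtain e where "a = Suc i + e" using Suc.prems le_Suc_ex by blast
      then have "a - Suc i = e" "a - i = Suc e" "e + 1 < a" using Suc.hyps by auto
      then show ?thesis by (simp only:) (simp add: prep_def)
    qed
    show "reach a M x i (cfg M (9 + (a - i)) (mvh hi MvS) (mvh hA MvS) (mvh hB MvS) (mvh (int m) MvR) ((ones m)(int m := One)))
        (cfg M 2 hi hA hB (int (Suc m + i)) (ones (Suc m + i)))"
      using Suc.IH[of "Suc m"] Suc.prems by (simp add: ones_Suc mvh_def add_ac)
  qed (use Suc in auto)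
  then show ?case by simp
qed

lemma run_A_to_B:
  "reach a M x (Suc d) (cfg M 2 hi (int d) hB hW tW) (cfg M 3 (hi + int d) 0 (hB + int d) hW tW)"
proof (induction d arbitrary: hi hB)
  case 0
  show ?case by (rule run_cfg_Suc) (auto simp: prep_def mvh_def)
next
  case (Suc d)
  have "reach a M x (Suc (Suc d)) (cfg M 2 hi (int (Suc d)) hB hW tW) (cfg M 3 (hi + 1 + int d) 0 (hB + 1 + int d) hW tW)"
  proof (rule run_cfg_Suc)
    show "prep a (9 + a + q0 M) 2 (inp_sym x hi) (mark (int (Suc d))) (mark hB) (tW hW) = (2, tW hW, MvR, MvL, MvR, MvS)"
      by (simp add: prep_def)
    show "reach a M x (Suc d) (cfg M 2 (mvh hi MvR) (mvh (int (Suc d)) MvL) (mvh hB MvR) (mvh hW MvS) (tW(hW := tW hW)))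
        (cfg M 3 (hi + 1 + int d) 0 (hB + 1 + int d) hW tW)"
      using Suc[of "hi + 1" "hB + 1"] by (simp add: mvh_def del: run.simps)
  qed auto
  then show ?case by (simp add: add_ac del: run.simps)
qed

text \<open>Each cell passed on B takes one step in state 3 and one in state 4, and both move A:
  this is the doubling.\<close>

lemma run_B_to_A:
  "reach a M x (Suc (2 * d)) (cfg M 3 hi hA (int d) hW tW) (cfg M 1 hi (hA + int (2 * d)) 0 hW tW)"
proof (induction d arbitrary: hA)
  case 0
  show ?case by (rule run_cfg_Suc) (auto simp: prep_def mvh_def)
next
  case (Suc d)
  have "reach a M x (Suc (Suc (Suc (2 * d)))) (cfg M 3 hi hA (int (Suc d)) hW tW) (cfg M 1 hi ((hA + 2) + int (2 * d)) 0 hW tW)"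
  proof (rule run_cfg_Suc)
    show "prep a (9 + a + q0 M) 3 (inp_sym x hi) (mark hA) (mark (int (Suc d))) (tW hW) = (4, tW hW, MvS, MvR, MvL, MvS)"
      by (simp add: prep_def)
    show "reach a M x (Suc (Suc (2 * d))) (cfg M 4 (mvh hi MvS) (mvh hA MvR) (mvh (int (Suc d)) MvL) (mvh hW MvS) (tW(hW := tW hW)))
       (cfg M 1 hi (hA + 2 + int (2 * d)) 0 hW tW)"
    proof (rule run_cfg_Suc)
      show "prep a (9 + a + q0 M) 4 (inp_sym x (mvh hi MvS)) (mark (mvh hA MvR)) (mark (mvh (int (Suc d)) MvL))
          ((tW(hW := tW hW)) (mvh hW MvS)) = (3, tW hW, MvS, MvR, MvS, MvS)"
        by (simp add: prep_def mvh_def)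
      show "reach a M x (Suc (2 * d)) (cfg M 3 (mvh (mvh hi MvS) MvS) (mvh (mvh hA MvR) MvR) (mvh (mvh (int (Suc d)) MvL) MvS)
          (mvh (mvh hW MvS) MvS) (tW(hW := tW hW, mvh hW MvS := tW hW)))
         (cfg M 1 hi (hA + 2 + int (2 * d)) 0 hW tW)"
        using Suc[of "hA + 2"] by (simp add: mvh_def add_ac)
    qed auto
  qed auto
  then show ?case by (simp add: add_ac)
qed


text \<open>The number of binary digits. Unlike in \<open>clog\<close> the inequality is strict,
  which matches the exit of the loop: cell \<open>2 ^ j - 1\<close> lies behind an input of length n
  iff \<open>n < 2 ^ j\<close>.\<close>

definition bitlen :: "nat \<Rightarrow> nat" where
  "bitlen n = (LEAST j. n < 2 ^ j)"

lemma less_power_bitlen: "n < 2 ^ bitlen n"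
  unfolding bitlen_def by (rule LeastI[of _ n]) simp

lemma power_le_of_less_bitlen: "j < bitlen n \<Longrightarrow> 2 ^ j \<le> n"
  unfolding bitlen_def using not_less_Least not_less by blast

lemma power_bitlen_le:
  assumes "n > 0"
  shows "2 ^ bitlen n \<le> 2 * n"
proof (cases "bitlen n")
  case (Suc j)
  then show ?thesis using power_le_of_less_bitlen[of j n] by simp
qed (use assms in simp)

lemma inp_sym_Blank: "inp_sym x i = Blank \<longleftrightarrow> i < 0 \<or> int (length x) \<le> i"
  by (auto simp: inp_sym_def)

text \<open>The input head has advanced by 1 + 2 + ... + 2^(j-1) = 2^j - 1 cells when round j
  begins. The cost is dominated by 3 * 2^j, so all rounds together are linear in the input length up
  to a logarithmic term.\<close>

lemma run_round:
  assumes a: "a \<ge> 1" and j: "2 ^ j \<le> length x"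
  shows "reach a M x (a + 3 * 2 ^ j + 3)
    (cfg M 1 (2 ^ j - 1) (2 ^ j) 0 (int (a * j)) (ones (a * j)))
    (cfg M 1 (2 ^ Suc j - 1) (2 ^ Suc j) 0 (int (a * Suc j)) (ones (a * Suc j)))"
proof -
  let ?p = "2 ^ j :: nat"
  have "(2::int) ^ j \<le> int (length x)" using j by simp
  moreover have "(1::int) \<le> 2 ^ j" by simp
  ultimately have nb: "inp_sym x (2 ^ j - 1) \<noteq> Blank" unfolding inp_sym_Blank by linarith
  have 1: "reach a M x 1 (cfg M 1 (2 ^ j - 1) (2 ^ j) 0 (int (a * j)) (ones (a * j)))
      (cfg M 9 (2 ^ j - 1) (2 ^ j) 0 (int (a * j)) (ones (a * j)))"
    unfolding One_nat_def by (rule run_cfg_Suc) (use nb in \<open>auto simp: prep_def mvh_def\<close>)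
  have 2: "reach a M x a (cfg M 9 (2 ^ j - 1) (2 ^ j) 0 (int (a * j)) (ones (a * j)))
      (cfg M 2 (2 ^ j - 1) (2 ^ j) 0 (int (a * Suc j)) (ones (a * Suc j)))"
    using run_write_ones[of a a M x "2 ^ j - 1" "2 ^ j" 0 "a * j"] a by (simp add: add_ac)
  have 3: "reach a M x (Suc ?p) (cfg M 2 (2 ^ j - 1) (2 ^ j) 0 (int (a * Suc j)) (ones (a * Suc j)))
      (cfg M 3 (2 ^ Suc j - 1) 0 (int ?p) (int (a * Suc j)) (ones (a * Suc j)))"
    using run_A_to_B[of a M x ?p "2 ^ j - 1" 0] by (simp add: del: run.simps)
  have 4: "reach a M x (Suc (2 * ?p)) (cfg M 3 (2 ^ Suc j - 1) 0 (int ?p) (int (a * Suc j)) (ones (a * Suc j)))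
      (cfg M 1 (2 ^ Suc j - 1) (2 ^ Suc j) 0 (int (a * Suc j)) (ones (a * Suc j)))"
    using run_B_to_A[of a M x ?p "2 ^ Suc j - 1" 0] by (simp del: run.simps)
  have "1 + (a + (Suc ?p + Suc (2 * ?p))) = a + 3 * 2 ^ j + 3" by simp
  then show ?thesis using run_trans[OF 1 run_trans[OF 2 run_trans[OF 3 4]]] by (simp only:)
qed

lemma run_rounds:
  assumes a: "a \<ge> 1" and j: "j \<le> bitlen (length x)"
  shows "\<exists>t \<le> j * (a + 3) + 3 * 2 ^ j. reach a M x t (cfg M 1 0 1 0 0 (\<lambda>_. Blank))
    (cfg M 1 (2 ^ j - 1) (2 ^ j) 0 (int (a * j)) (ones (a * j)))"
  using j
proof (induction j)
  case 0
  show ?case by (rule exI[of _ 0]) (simp add: ones_0)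
next
  case (Suc j)
  then obtain t where t: "t \<le> j * (a + 3) + 3 * 2 ^ j" "reach a M x t (cfg M 1 0 1 0 0 (\<lambda>_. Blank))
    (cfg M 1 (2 ^ j - 1) (2 ^ j) 0 (int (a * j)) (ones (a * j)))" by auto
  have "2 ^ j \<le> length x" using power_le_of_less_bitlen[of j "length x"] Suc.prems by simp
  from run_trans[OF t(2) run_round[OF a this]] t(1) show ?case
    by (intro exI[of _ "t + (a + 3 * 2 ^ j + 3)"]) (simp del: run.simps)
qed

text \<open>The mark on A signals the end. In the intended use A stands one cell to the right of the
  input head, which therefore overshoots to cell -1 and is moved back by the last step.\<close>

lemma run_rewind_input:
  "reach a M x (Suc d) (cfg M 5 hi (int d) hB hW tW) (cfg M 6 (hi - int d + 1) 0 hB (hW - 1) tW)"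
proof (induction d arbitrary: hi)
  case 0
  show ?case by (rule run_cfg_Suc) (auto simp: prep_def mvh_def)
next
  case (Suc d)
  have "reach a M x (Suc (Suc d)) (cfg M 5 hi (int (Suc d)) hB hW tW) (cfg M 6 ((hi - 1) - int d + 1) 0 hB (hW - 1) tW)"
  proof (rule run_cfg_Suc)
    show "prep a (9 + a + q0 M) 5 (inp_sym x hi) (mark (int (Suc d))) (mark hB) (tW hW) = (5, tW hW, MvL, MvL, MvS, MvS)"
      by (simp add: prep_def)
    show "reach a M x (Suc d) (cfg M 5 (mvh hi MvL) (mvh (int (Suc d)) MvL) (mvh hB MvS) (mvh hW MvS) (tW(hW := tW hW)))
        (cfg M 6 (hi - 1 - int d + 1) 0 hB (hW - 1) tW)"
      using Suc[of "hi - 1"] by (simp add: mvh_def del: run.simps)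
  qed auto
  then show ?case by (simp add: algebra_simps del: run.simps)
qed

lemma run_rewind_ones:
  "d \<le> m \<Longrightarrow> reach a M x (Suc d) (cfg M 6 hi hA hB (int d - 1) (ones m)) (cfg M 7 hi hA hB 0 (ones m))"
proof (induction d)
  case 0
  show ?case by (rule run_cfg_Suc) (auto simp: prep_def mvh_def ones_Blank ones_upd_Blank)
next
  case (Suc d)
  show ?case
  proof (rule run_cfg_Suc)
    show "prep a (9 + a + q0 M) 6 (inp_sym x hi) (mark hA) (mark hB) (ones m (int (Suc d) - 1)) = (6, ones m (int (Suc d) - 1), MvS, MvS, MvS, MvL)"
      using Suc.prems by (simp add: prep_def ones_def)
    show "reach a M x (Suc d) (cfg M 6 (mvh hi MvS) (mvh hA MvS) (mvh hB MvS) (mvh (int (Suc d) - 1) MvL)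
        ((ones m)(int (Suc d) - 1 := ones m (int (Suc d) - 1)))) (cfg M 7 hi hA hB 0 (ones m))"
      using Suc by (simp add: mvh_def del: run.simps)
  qed auto
qed

definition half_copied :: "bool list \<Rightarrow> nat \<Rightarrow> nat \<Rightarrow> int \<Rightarrow> sym" where
  "half_copied x m i j = (if 0 \<le> j \<and> j < int i then inp_sym x j else ones m j)"

text \<open>The remaining ones on W, not the input, determine when copying stops; an input shorter
  than m just contributes blanks. A moves along with W, so that its mark can guide the later
  rewinding even if W contains such blanks.\<close>

lemma run_copy:
  "d \<le> m \<Longrightarrow> reach a M x (Suc d)
    (cfg M 7 (int (m - d)) (int (m - d)) hB (int (m - d)) (half_copied x m (m - d)))
    (cfg M 8 (int m) (int m) hB (int m) (half_copied x m m))"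
proof (induction d)
  case 0
  have "half_copied x m m (int m) = Blank" by (simp add: half_copied_def ones_def)
  moreover from this have "(half_copied x m m)(int m := Blank) = half_copied x m m" by (metis fun_upd_triv)
  ultimately show ?case unfolding diff_zero by (intro run_cfg_Suc) (auto simp: prep_def mvh_def)
next
  case (Suc d)
  let ?i = "m - Suc d"
  show ?case
  proof (rule run_cfg_Suc)
    show "prep a (9 + a + q0 M) 7 (inp_sym x (int ?i)) (mark (int ?i)) (mark hB) (half_copied x m ?i (int ?i)) =
        (7, inp_sym x (int ?i), MvR, MvR, MvS, MvR)"
      using Suc.prems by (simp add: prep_def half_copied_def ones_def)
    have "(half_copied x m ?i)(int ?i := inp_sym x (int ?i)) = half_copied x m (m - d)"
      using Suc.prems by (auto simp: half_copied_def fun_eq_iff)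
    moreover have "int ?i + 1 = int (m - d)" using Suc.prems by simp
    ultimately show "reach a M x (Suc d) (cfg M 7 (mvh (int ?i) MvR) (mvh (int ?i) MvR) (mvh hB MvS) (mvh (int ?i) MvR)
        ((half_copied x m ?i)(int ?i := inp_sym x (int ?i))))
        (cfg M 8 (int m) (int m) hB (int m) (half_copied x m m))"
      using Suc by (simp add: mvh_def del: run.simps)
  qed auto
qed

lemma half_copied_full: "half_copied x m m = inp_sym (take m x)"
  by (auto simp: half_copied_def ones_def inp_sym_def fun_eq_iff)

lemma run_rewind_copy:
  "reach a M x (Suc d) (cfg M 8 hi (int d) hB (int d) tW) (cfg M (9 + a + q0 M) hi 0 hB 0 tW)"
proof (induction d)
  case 0
  show ?case by (rule run_cfg_Suc) (auto simp: prep_def mvh_def)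
next
  case (Suc d)
  show ?case
  proof (rule run_cfg_Suc)
    show "prep a (9 + a + q0 M) 8 (inp_sym x hi) (mark (int (Suc d))) (mark hB) (tW (int (Suc d))) = (8, tW (int (Suc d)), MvS, MvL, MvS, MvL)"
      by (simp add: prep_def)
    show "reach a M x (Suc d) (cfg M 8 (mvh hi MvS) (mvh (int (Suc d)) MvL) (mvh hB MvS) (mvh (int (Suc d)) MvL)
        (tW(int (Suc d) := tW (int (Suc d))))) (cfg M (9 + a + q0 M) hi 0 hB 0 tW)"
      using Suc by (simp add: mvh_def del: run.simps)
  qed auto
qed

section \<open>Padded languages and their running time\<close>

definition padded :: "nat \<Rightarrow> (bool list \<Rightarrow> bool) \<Rightarrow> bool list \<Rightarrow> bool" where
  "padded a g x = g (take (a * bitlen (length x)) x)"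

lemma run_prep:
  fixes x :: "bool list"
  assumes a: "a \<ge> 1"
  defines "J \<equiv> bitlen (length x)"
  shows "\<exists>t \<le> 6 + J * (4 * a + 3) + 4 * 2 ^ J. \<exists>hi. reach a M x t (init_config (pad_tm a M))
     (cfg M (9 + a + q0 M) hi 0 0 0 (inp_sym (take (a * J) x)))"
proof -
  let ?m = "a * J"
  obtain t where t: "t \<le> J * (a + 3) + 3 * 2 ^ J" "reach a M x t (cfg M 1 0 1 0 0 (\<lambda>_. Blank))
    (cfg M 1 (2 ^ J - 1) (2 ^ J) 0 (int ?m) (ones ?m))"
    using run_rounds[OF a, of J x M] unfolding J_def by auto
  have "int (length x) < int (2 ^ J)" unfolding J_def using less_power_bitlen by (simp only: of_nat_less_iff)
  then have b: "inp_sym x (2 ^ J - 1) = Blank" by (simp add: inp_sym_Blank)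
  have 1: "reach a M x 1 (cfg M 1 (2 ^ J - 1) (2 ^ J) 0 (int ?m) (ones ?m)) (cfg M 5 (2 ^ J - 1) (2 ^ J) 0 (int ?m) (ones ?m))"
    unfolding One_nat_def by (rule run_cfg_Suc) (use b in \<open>auto simp: prep_def mvh_def\<close>)
  have 2: "reach a M x (Suc (2 ^ J)) (cfg M 5 (2 ^ J - 1) (2 ^ J) 0 (int ?m) (ones ?m)) (cfg M 6 0 0 0 (int ?m - 1) (ones ?m))"
    using run_rewind_input[of a M x "2 ^ J" "2 ^ J - 1" 0] by (simp del: run.simps)
  have 3: "reach a M x (Suc ?m) (cfg M 6 0 0 0 (int ?m - 1) (ones ?m)) (cfg M 7 0 0 0 0 (ones ?m))"
    by (rule run_rewind_ones) simp
  have "half_copied x ?m 0 = ones ?m" by (auto simp: half_copied_def fun_eq_iff)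
  then have 4: "reach a M x (Suc ?m) (cfg M 7 0 0 0 0 (ones ?m)) (cfg M 8 (int ?m) (int ?m) 0 (int ?m) (inp_sym (take ?m x)))"
    using run_copy[of ?m ?m a M x 0] unfolding half_copied_full by (simp del: run.simps)
  have 5: "reach a M x (Suc ?m) (cfg M 8 (int ?m) (int ?m) 0 (int ?m) (inp_sym (take ?m x)))
      (cfg M (9 + a + q0 M) (int ?m) 0 0 0 (inp_sym (take ?m x)))"
    by (rule run_rewind_copy)
  note r = run_trans[OF run_start run_trans[OF t(2) run_trans[OF 1 run_trans[OF 2 run_trans[OF 3 run_trans[OF 4 5]]]]]]
  have "1 + (t + (1 + (Suc (2 ^ J) + (Suc ?m + (Suc ?m + Suc ?m))))) \<le> 6 + J * (4 * a + 3) + 4 * 2 ^ J"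
    using t(1) by (simp add: algebra_simps)
  with r show ?thesis by blast
qed

lemma halts_pad_tm:
  assumes M: "wf_tm M" "nin M = 1" and a: "a \<ge> 1"
    and h: "halts_within M [take (a * bitlen (length x)) x] t b"
  shows "\<exists>s \<le> 6 + bitlen (length x) * (4 * a + 3) + 4 * 2 ^ bitlen (length x) + t.
    halts_within (pad_tm a M) [x] s b"
proof -
  let ?J = "bitlen (length x)"
  let ?y = "take (a * ?J) x"
  obtain s hi where s: "s \<le> 6 + ?J * (4 * a + 3) + 4 * 2 ^ ?J" "reach a M x s (init_config (pad_tm a M))
     (cfg M (9 + a + q0 M) hi 0 0 0 (inp_sym ?y))"
    using run_prep[OF a, of x M] by blast
  obtain q hs ws where c: "run M [?y] t (init_config M) = Some (q, hs, ws)" "halted M (q, hs, ws)" "b = (q = qacc M)"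
    using h unfolding halts_within_def by auto
  have "run M [?y] t (q0 M, 0 # replicate (nwork M) 0, replicate (nwork M) (\<lambda>_. Blank)) = Some (q, hs, ws)"
    using c(1) M(2) by (simp add: init_config_def)
  from run_lift[OF M _ _ this, of a x hi 0 0 mark mark]
  obtain c' where c': "reach a M x t (cfg M (9 + a + q0 M) hi 0 0 0 (inp_sym ?y)) (9 + a + q, c')"
    by (auto simp: cfg_def)
  have "halted (pad_tm a M) (9 + a + q, c')" using c(2) halted_pad_tm[of a M q c' "(hs, ws)"] by simp
  then have "halts_within (pad_tm a M) [x] (s + t) b"
    unfolding halts_within_def using run_trans[OF s(2) c'] c(3) by (intro exI[of _ "(9 + a + q, c')"]) simp
  then show ?thesis using s(1) by (intro exI[of _ "s + t"]) simp
qed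

text \<open>With J the bit length of n, running M on the prefix takes at most 2^(C * (a * J + 1)) =
  2^C * (2^J)^(a * C) steps, and 2^J \<le> 2 * n makes this polynomial of degree a * C. The
  additional 1 in the exponent leaves room for the preparation phase.\<close>

lemma padded_computable:
  assumes d: "decides_in_time M g (\<lambda>n. 2 ^ (C * (n + 1)))" and a: "a \<ge> 1"
  shows "computable_in_time_pow (padded a g) (real (a * C + 1))"
proof -
  have M: "wf_tm M" "nin M = 1" using d by (auto simp: decides_in_time_def)
  define K :: nat where "K = 6 + 2 * (4 * a + 3) + 8 + 2 ^ C * 2 ^ (a * C)"
  have halt: "\<exists>s \<le> 6 + bitlen (length x) * (4 * a + 3) + 4 * 2 ^ bitlen (length x) + 2 ^ (C * (a * bitlen (length x) + 1)).
      halts_within (pad_tm a M) [x] s (padded a g x)" for x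
  proof -
    let ?y = "take (a * bitlen (length x)) x"
    obtain t where t: "t \<le> 2 ^ (C * (length ?y + 1))" "halts_within M [?y] t (g ?y)"
      using d unfolding decides_in_time_def by blast
    have "C * (length ?y + 1) \<le> C * (a * bitlen (length x) + 1)" by (intro mult_le_mono2) simp
    then have "(2::nat) ^ (C * (length ?y + 1)) \<le> 2 ^ (C * (a * bitlen (length x) + 1))" by (rule power_increasing) simp
    with t(1) have "t \<le> 2 ^ (C * (a * bitlen (length x) + 1))" by (rule le_trans)
    then show ?thesis using halts_pad_tm[OF M a t(2)] unfolding padded_def
      by (meson add_left_mono le_trans)
  qed
  have bound: "6 + bitlen n * (4 * a + 3) + 4 * 2 ^ bitlen n + 2 ^ (C * (a * bitlen n + 1)) \<le> K * n ^ (a * C + 1)"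
    if n: "n \<ge> 1" for n
  proof -
    have p: "2 ^ bitlen n \<le> 2 * n" using power_bitlen_le n by simp
    have b: "bitlen n \<le> 2 * n" using p less_exp[of "bitlen n"] by linarith
    have n1: "n \<le> n ^ (a * C + 1)" using n by simp
    have "(2::nat) ^ (C * (a * bitlen n + 1)) = 2 ^ C * (2 ^ bitlen n) ^ (a * C)"
      by (simp add: power_add power_mult[symmetric] algebra_simps)
    also have "\<dots> \<le> 2 ^ C * (2 * n) ^ (a * C)" using p by (intro mult_le_mono2 power_mono) auto
    also have "\<dots> = 2 ^ C * 2 ^ (a * C) * n ^ (a * C)" by (simp add: power_mult_distrib)
    also have "\<dots> \<le> 2 ^ C * 2 ^ (a * C) * n ^ (a * C + 1)" using n by (intro mult_le_mono2) simp
    finally have e: "2 ^ (C * (a * bitlen n + 1)) \<le> 2 ^ C * 2 ^ (a * C) * n ^ (a * C + 1)" .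
    have "6 + bitlen n * (4 * a + 3) + 4 * 2 ^ bitlen n \<le> 6 * n + 2 * n * (4 * a + 3) + 8 * n"
      using p b n mult_le_mono1[OF b, of "4 * a + 3"] by linarith
    also have "\<dots> = (6 + 2 * (4 * a + 3) + 8) * n" by (simp add: algebra_simps)
    also have "\<dots> \<le> (6 + 2 * (4 * a + 3) + 8) * n ^ (a * C + 1)" using n1 by (rule mult_le_mono2)
    finally show ?thesis using e unfolding K_def add_mult_distrib by linarith
  qed
  show ?thesis
    unfolding computable_in_time_pow_def
  proof (rule exI[of _ "pad_tm a M"], rule exI[of _ "real K"], rule exI[of _ 1], intro conjI allI impI)
    show "wf_tm (pad_tm a M)" using wf_pad_tm M by blast
    show "nin (pad_tm a M) = 1" by simp
    fix x
    show "\<exists>t. halts_within (pad_tm a M) [x] t (padded a g x)" using halt by blast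
  next
    fix x :: "bool list" assume x: "length x \<ge> 1"
    obtain s where s: "s \<le> K * length x ^ (a * C + 1)" "halts_within (pad_tm a M) [x] s (padded a g x)"
      using halt[of x] bound[OF x] le_trans by blast
    have "real s \<le> real (K * length x ^ (a * C + 1))" using s(1) by (simp only: of_nat_le_iff)
    also have "\<dots> = real K * real (length x) powr real (a * C + 1)"
      using x by (subst powr_realpow) auto
    finally show "\<exists>t. real t \<le> real K * real (length x) powr real (a * C + 1) \<and>
        halts_within (pad_tm a M) [x] t (padded a g x)" using s(2) by blast
  qed
qed

section \<open>Sample efficiency gain\<close>

text \<open>Writing J for the bit length, the assumption forces 4 * a < J, and then 4 * a * J \<le>
  J^2 \<le> 2 * 2^J \<le> 4 * n.\<close>

lemma mult_bitlen_le:
  assumes n: "2 ^ (4 * a) \<le> n"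
  shows "a * bitlen n \<le> n"
proof -
  let ?J = "bitlen n"
  have sq: "j * j \<le> 2 * 2 ^ j" for j :: nat
  proof (induction j)
    case (Suc j)
    moreover have "j < 2 ^ j" by (rule less_exp)
    ultimately show ?case unfolding power_Suc mult_Suc mult_Suc_right by linarith
  qed simp
  have "(2::nat) ^ (4 * a) < 2 ^ ?J" using n less_power_bitlen[of n] by linarith
  then have "4 * a < ?J" by (rule power_less_imp_less_exp[rotated]) simp
  then have "4 * a * ?J \<le> ?J * ?J" by (intro mult_le_mono1) simp
  also have "\<dots> \<le> 2 * 2 ^ ?J" by (rule sq)
  also have "0 < n" using n by (metis gr0I le_zero_eq power_not_zero zero_neq_numeral)
  then have "2 * 2 ^ ?J \<le> 4 * n" using power_bitlen_le[of n] by simp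
  finally show ?thesis by simp
qed

text \<open>The padded function ignores everything behind the prefix, so those inputs may all be
  wired to input 0.\<close>

lemma has_circ_of_padded:
  assumes "has_circ n s (padded a g)" "a * bitlen n \<le> n" "a * bitlen n \<ge> 1"
  shows "has_circ (a * bitlen n) s g"
proof (rule has_circ_ren_inp[OF assms(1), where r = "\<lambda>i. if i < a * bitlen n then i else 0"])
  fix x :: "bool list" assume l: "length x = a * bitlen n"
  let ?z = "map (\<lambda>i. x ! (if i < a * bitlen n then i else 0)) [0..<n]"
  have "take (a * bitlen n) ?z = x"
    using l assms(2) by (intro nth_equalityI) auto
  then show "g x = padded a g ?z" unfolding padded_def by simp
qed (use assms(3) in auto)

text \<open>With J the bit length of n, the hardness 2^(\<iota> * a * J) is (2^J)^(\<iota> * a), and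
  2^J exceeds n.\<close>

lemma padded_hard:
  assumes hard: "\<And>n vs. circ_computes n vs g \<Longrightarrow> real (length vs) \<ge> 2 powr (\<iota> * real n)"
    and a: "a \<ge> 1" "k \<le> \<iota> * real a" "0 < \<iota>" and n: "2 ^ (4 * a) \<le> n" and c: "has_circ n s (padded a g)"
  shows "real n powr k \<le> real s"
proof -
  have n0: "n \<ge> 1" using n by (metis le_trans one_le_numeral one_le_power)
  have "bitlen n > 0" using less_power_bitlen[of n] n0 by (cases "bitlen n") auto
  then have "a * bitlen n \<ge> 1" using a(1) by (simp add: Suc_le_eq)
  then obtain vs where vs: "length vs \<le> s" "circ_computes (a * bitlen n) vs g"
    using has_circ_of_padded[OF c mult_bitlen_le[OF n]] unfolding has_circ_def by blast
  have "real n powr k \<le> real n powr (\<iota> * real a)" using a(2) n0 by (intro powr_mono) auto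
  also have "\<dots> \<le> (2 ^ bitlen n) powr (\<iota> * real a)"
  proof (rule powr_mono2)
    have "real n < real (2 ^ bitlen n)" using less_power_bitlen by (simp only: of_nat_less_iff)
    then show "real n \<le> 2 ^ bitlen n" by simp
  qed (use a(3) in auto)
  also have "\<dots> = 2 powr (\<iota> * real (a * bitlen n))"
    by (simp add: powr_realpow[symmetric] powr_powr mult_ac)
  also have "\<dots> \<le> real (length vs)" by (rule hard[OF vs(2)])
  finally show ?thesis using vs(1) by linarith
qed

lemma gain_ge:
  assumes "set_pmf P \<subseteq> {x. length x = n}" "desc_len \<phi> n f \<le> enat (n ^ d)"
    and "sample_cplx \<psi> sel\<psi> n \<epsilon> \<delta> f P \<ge> enat m" "sample_cplx \<phi> sel\<phi> n \<epsilon> \<delta> f P = enat k" "k \<ge> 1" "k \<le> M"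
    and r: "r * real M \<le> real m" "r \<ge> 0"
  shows "gain d \<phi> sel\<phi> \<psi> sel\<psi> \<epsilon> \<delta> n \<ge> ereal r"
  unfolding gain_def
proof (rule SUP_upper2[of "(f, P)"])
  show "(f, P) \<in> {(f, P). set_pmf P \<subseteq> {x. length x = n} \<and> desc_len \<phi> n f \<le> enat (n ^ d)}"
    using assms(1,2) by simp
  have "r * real k \<le> r * real M" using assms(6) r(2) by (intro mult_left_mono) auto
  then have "r \<le> real m / real k" using r(1) assms(5) by (simp add: field_simps)
  then have "ereal r \<le> ereal_of_enat (enat m) / ereal_of_enat (enat k)" using assms(5) by simp
  also have "\<dots> \<le> ereal_of_enat (sample_cplx \<psi> sel\<psi> n \<epsilon> \<delta> f P) / ereal_of_enat (enat k)"
    using assms(3,5) by (intro ereal_divide_right_mono) (simp_all del: ereal_of_enat_simps(1) add: zero_enat_def)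
  finally show "ereal r \<le> (case (f, P) of (f, P) \<Rightarrow>
      ereal_of_enat (sample_cplx \<psi> sel\<psi> n \<epsilon> \<delta> f P) / ereal_of_enat (sample_cplx \<phi> sel\<phi> n \<epsilon> \<delta> f P))"
    using assms(4) by simp
qed

lemma desc_len_le:
  assumes "\<And>x. length x = n \<Longrightarrow> \<phi> h x = Some (f x)"
  shows "desc_len \<phi> n f \<le> enat (length h)"
proof -
  have "(LEAST l. \<exists>h. length h = l \<and> (\<forall>x. length x = n \<longrightarrow> \<phi> h x = Some (f x))) \<le> length h"
    by (rule Least_le) (use assms in blast)
  then show ?thesis unfolding desc_len_def using assms by auto
qed

text \<open>Rounding up at most doubles n^(1 + \<gamma>), and the inner factor is at most 9 * n * m,
  so the left side is at most 8 * 9 * 2 = 144 times n^(5 + \<gamma>). The bound 13 is there because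
  144 < 13^2 \<le> n^2.\<close>

lemma size_lt_powr:
  fixes \<gamma> :: real
  assumes "\<gamma> > 0" "n \<ge> 13"
  shows "real (8 * n ^ 3 * (5 + (3 * n + 1) * nat \<lceil>real n powr (1 + \<gamma>)\<rceil>)) < real n powr (7 + \<gamma>)"
proof -
  let ?x = "real n powr (1 + \<gamma>)"
  define m where "m = nat \<lceil>?x\<rceil>"
  have "?x \<ge> 1" using assms by (intro ge_one_powr_ge_zero) auto
  then have m1: "real m \<ge> 1" and m2: "real m \<le> 2 * ?x" unfolding m_def by linarith+
  have "1 * 1 \<le> real n * real m" "1 * real m \<le> real n * real m"
    using mult_mono[of 1 "real n" 1 "real m"] mult_right_mono[of 1 "real n" "real m"] assms(2) m1
    by simp_all
  then have "5 + (3 * real n + 1) * real m \<le> 9 * (real n * real m)" by (simp add: algebra_simps)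
  also have "\<dots> \<le> 9 * (real n * (2 * ?x))" using m2 by (intro mult_left_mono) auto
  finally have "8 * real n ^ 3 * (5 + (3 * real n + 1) * real m) \<le> 8 * real n ^ 3 * (9 * (real n * (2 * ?x)))"
    by (rule mult_left_mono) simp
  then have "real (8 * n ^ 3 * (5 + (3 * n + 1) * m)) \<le> 8 * real n ^ 3 * (9 * (real n * (2 * ?x)))"
    by (simp only: of_nat_mult of_nat_add of_nat_power of_nat_numeral of_nat_1)
  also have "\<dots> = 144 * (real n ^ 4 * ?x)" by (simp add: power_numeral_reduce)
  also have "\<dots> < real n ^ 2 * (real n ^ 4 * ?x)"
  proof (rule mult_strict_right_mono)
    have "13 ^ 2 \<le> real n ^ 2" using assms(2) by (intro power_mono) auto
    then show "144 < real n ^ 2" by simp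
    show "0 < real n ^ 4 * ?x" using assms(2) by simp
  qed
  also have "\<dots> = real n powr 2 * (real n powr 4 * ?x)" using assms(2) by simp
  also have "\<dots> = real n powr (7 + \<gamma>)" by (simp only: powr_add[symmetric]) (simp add: add_ac)
  finally show ?thesis unfolding m_def .
qed

theorem theorem7:
  fixes U :: "nat \<Rightarrow> interp" and selU :: "nat \<Rightarrow> selector" and selC :: selector
  assumes U: "\<forall>c \<ge> 1. time_bounded_universal c (U c)"
    and selU: "\<forall>c. valid_selector (selU c)" and selC: "valid_selector selC"
    and hard: "\<exists>g \<iota>. in_E g \<and> \<iota> > 0 \<and>
       (\<forall>n vs. circ_computes n vs g \<longrightarrow> real (length vs) \<ge> 2 powr (\<iota> * real n))"
  shows "\<forall>\<gamma> > 0. \<exists>\<epsilon> \<delta> c d. 0 < \<epsilon> \<and> \<epsilon> < 1/2 \<and> 0 < \<delta> \<and> \<delta> < 1 \<and> c \<ge> 1 \<and> d \<ge> 1 \<and>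
     (\<exists>K > 0. \<forall>\<^sub>F n in sequentially.
        gain d (U c) (selU c) circuit_interp selC \<epsilon> \<delta> n \<ge> ereal (K * real n powr (1 + \<gamma>)))"
proof (intro allI impI)
  fix \<gamma> :: real assume \<gamma>: "\<gamma> > 0"
  obtain g \<iota> where g: "in_E g" and \<iota>: "\<iota> > 0"
    and hard_g: "\<And>n vs. circ_computes n vs g \<Longrightarrow> real (length vs) \<ge> 2 powr (\<iota> * real n)"
    using hard by blast
  obtain T C where T: "decides_in_time T g (\<lambda>n. 2 ^ (C * (n + 1)))"
    using g unfolding in_E_def by blast
  \<comment> \<open>Chosen so that the hardness n^(\<iota> * a) reaches n^(7 + \<gamma>).\<close>
  define a where "a = nat \<lceil>(7 + \<gamma>) / \<iota>\<rceil>"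
  have "(7 + \<gamma>) / \<iota> > 0" using \<gamma> \<iota> by simp
  then have a: "a \<ge> 1" "(7 + \<gamma>) / \<iota> \<le> real a" unfolding a_def by linarith+
  have a\<iota>: "7 + \<gamma> \<le> \<iota> * real a" using a(2) \<iota> by (simp add: field_simps)
  define f where "f = padded a g"
  \<comment> \<open>\<open>time_bounded_universal\<close> asks for an exponent strictly below c, and
    the padded language has exponent \<open>a * C + 1\<close>.\<close>
  define c where "c = a * C + 2"
  have "time_bounded_universal c (U c)" using U by (simp add: c_def)
  moreover have "computable_in_time_pow f (real (a * C + 1))" "real (a * C + 1) < real c"
    using padded_computable[OF T a(1)] by (simp_all add: f_def c_def)
  ultimately obtain h N where h: "\<And>x. length x \<ge> N \<Longrightarrow> U c h x = Some (f x)"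
    unfolding time_bounded_universal_def by blast
  obtain M where M: "M \<ge> 1" "\<forall>\<phi> sel n f P h'. valid_selector sel \<longrightarrow> length h' = length h \<longrightarrow>
      (\<forall>x. length x = n \<longrightarrow> \<phi> h' x = Some (f x)) \<longrightarrow> set_pmf P \<subseteq> {x. length x = n} \<longrightarrow>
      (\<exists>k. 1 \<le> k \<and> k \<le> M \<and> sample_cplx \<phi> sel n (1/6) (1/2) f P = enat k)"
    using mdl_realizable_sample_cplx[of "1/6" "1/2" "length h"] by auto
  \<comment> \<open>The thresholds are N for h to be correct, \<open>length h\<close> for d = 1, 13
    for \<open>size_lt_powr\<close>, and \<open>2 ^ (4 * a)\<close> for the prefix to fit into the
    input.\<close>
  have "gain 1 (U c) (selU c) circuit_interp selC (1/6) (1/2) n \<ge> ereal (1 / real M * real n powr (1 + \<gamma>))"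
    if n: "n \<ge> max (max N (length h)) (max 13 (2 ^ (4 * a)))" for n
  proof -
    let ?m = "nat \<lceil>real n powr (1 + \<gamma>)\<rceil>"
    have hn: "U c h x = Some (f x)" if "length x = n" for x using h n that by simp
    have "\<not> has_circ n (8 * n ^ 3 * (5 + (3 * n + 1) * ?m)) f"
    proof
      assume c: "has_circ n (8 * n ^ 3 * (5 + (3 * n + 1) * ?m)) f"
      have "real n powr (7 + \<gamma>) \<le> real (8 * n ^ 3 * (5 + (3 * n + 1) * ?m))"
        by (rule padded_hard[OF hard_g a(1) a\<iota> \<iota> _ c[unfolded f_def]]) (use n in simp_all)
      then show False using size_lt_powr[OF \<gamma>, of n] n by linarith
    qed
    then obtain P where P: "set_pmf P \<subseteq> {x. length x = n}"
      "sample_cplx circuit_interp selC n (1/6) (1/2) f P \<ge> enat ?m"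
      using circuit_sample_cplx_ge[of n selC ?m f] selC n by auto
    obtain k where k: "1 \<le> k" "k \<le> M" "sample_cplx (U c) (selU c) n (1/6) (1/2) f P = enat k"
      using M(2)[rule_format, of "selU c" h n "U c" f P] selU hn P(1) by blast
    have "desc_len (U c) n f \<le> enat (length h)" using hn by (rule desc_len_le)
    also have "\<dots> \<le> enat (n ^ 1)" using n by simp
    finally have d: "desc_len (U c) n f \<le> enat (n ^ 1)" .
    show ?thesis
      \<comment> \<open>The ratio is at least \<open>?m / M\<close>, and rounding up made
        \<open>?m\<close> at least n^(1 + \<gamma>); so the constant in the lower bound is 1 /
        M.\<close>
      by (rule gain_ge[OF P(1) d P(2) k(3,1,2)]) (use M(1) in \<open>auto simp: real_nat_ceiling_ge\<close>)
  qed
  then have "\<forall>\<^sub>F n in sequentially.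
      gain 1 (U c) (selU c) circuit_interp selC (1/6) (1/2) n \<ge> ereal (1 / real M * real n powr (1 + \<gamma>))"
    unfolding eventually_sequentially by blast
  moreover have "1 / real M > 0" "c \<ge> 1" using M(1) by (simp_all add: c_def)
  ultimately show "\<exists>\<epsilon> \<delta> c d. 0 < \<epsilon> \<and> \<epsilon> < 1/2 \<and> 0 < \<delta> \<and> \<delta> < 1 \<and> c \<ge> 1 \<and> d \<ge> 1 \<and>
     (\<exists>K > 0. \<forall>\<^sub>F n in sequentially.
        gain d (U c) (selU c) circuit_interp selC \<epsilon> \<delta> n \<ge> ereal (K * real n powr (1 + \<gamma>)))"
    by (intro exI[of _ "1/6"] exI[of _ "1/2"] exI[of _ c] exI[of _ 1] conjI exI[of _ "1 / real M"]) auto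
qed

end
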